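(* Let $L^\circ$ be a cap of the Legendrian Hopf link $\Lambda_{\mathrm{Ho}}$ diffeomorphic to a cylinder. The homology of the capped Chekanov–Eliashberg algebra of the Hopf link with the cylinder cap is \[ H\big(CE(\Lambda_{\mathrm{Ho}};\mathbb{C}[\pi_1(L^\circ)])\big)=\mathbb{C}[p,q]\big[(1+pq)^{-1}\big], \] where $\mathbb{C}[p,q][(1+pq)^{-1}]$ is the localization of the commutative polynomial algebra $\mathbb{C}[p,q]$ at the multiplicative system $\{(1+pq)^n\}_{n=1,2,\dots}$, a smooth affine commutative algebra concentrated in degree zero.
   Context: The dg-algebra $CE(\Lambda_{\mathrm{Ho}};\mathbb{C}[\pi_1(L^\circ)])$ is the following. Its underlying unital graded associative algebra is \[ \mathcal{A}=\mathbb{C}\langle a_1,a_2,p,q,t,t^{-1}\rangle , \] the free tensor ring over $\mathbb{C}[t,t^{-1}]=\mathbb{C}[\pi_1(L^\circ)]$ generated by $a_1,a_2,p,q$ (so $tt^{-1}=t^{-1}t=1$ are the only relations; in particular $t$ does not commute with the other generators), with $|a_1|=|a_2|=1$ and $|p|=|q|=|t^{\pm1}|=0$. The differential $d$ has degree $-1$, satisfies the graded Leibniz rule, vanishes on $p,q,t^{\pm1}$, and \[ da_1=1-t+qp,\qquad da_2=1-t+pq . \] (Here $a_1,a_2,p,q$ are the Reeb chords of the Legendrian Hopf link $\Lambda_{\mathrm{Ho}}$ in a Darboux ball of the standard contact $S^3$, and $t$ generates $\pi_1$ of the cylinder $L^\circ$.) *)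

theory Defs
  imports
    Complex_Main
    "HOL-Library.Poly_Mapping"
    "HOL-Computational_Algebra.Polynomial"
    "HOL-Algebra.QuotRing"
    "HOL-Algebra.Generated_Rings"
    "HOL-Algebra.Algebraic_Closure_Type"
begin

section \<open>The free tensor ring over the Laurent polynomials\<close>

datatype hopf_gen = A1 | A2 | P | Q

text \<open>
  The monomials \<open>t^m0 g1 t^m1 g2 \<dots> gk t^mk\<close>, with arbitrary integer exponents, form a complex
  basis of the tensor ring of the free \<open>\<complex>[t,t\<^sup>-\<^sup>1]\<close>-bimodule on the generators \<open>g\<close>, that is, of the
  free algebra on \<open>a1, a2, p, q, t, t\<^sup>-\<^sup>1\<close> modulo \<open>t t\<^sup>-\<^sup>1 = t\<^sup>-\<^sup>1 t = 1\<close>.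
  \<open>Tpow m\<close> is \<open>t^m\<close> and \<open>Gen m g w\<close> is \<open>t^m g w\<close>.
\<close>

datatype hopf_word = Tpow int | Gen int hopf_gen hopf_word

text \<open>
  The concatenation of monomials is written additively (although it is not commutative), because
  the multiplication on \<^typ>\<open>'a \<Rightarrow>\<^sub>0 'b\<close> is the convolution over an additively written monoid.
\<close>

instantiation hopf_word :: monoid_add
begin

definition zero_hopf_word :: hopf_word where "0 = Tpow 0"

fun plus_hopf_word :: "hopf_word \<Rightarrow> hopf_word \<Rightarrow> hopf_word" where
  "Tpow m + Tpow n = Tpow (m + n)"
| "Tpow m + Gen n g v = Gen (m + n) g v"
| "Gen m g w + v = Gen m g (w + v)"

instance
proof
  fix u v w :: hopf_word
  show "u + v + w = u + (v + w)"
  proof (induction u)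
    case (Tpow m)
    show ?case by (cases v; cases w) (simp_all add: add.assoc)
  qed simp
  show "0 + u = u" by (cases u) (simp_all add: zero_hopf_word_def)
  show "u + 0 = u"
    by (induction u) (simp_all add: zero_hopf_word_def)
qed

end

type_synonym hopf_alg = "hopf_word \<Rightarrow>\<^sub>0 complex"

definition hopf_scalar :: "complex \<Rightarrow> hopf_alg" where
  "hopf_scalar c = Poly_Mapping.single 0 c"

definition hopf_mon :: "hopf_word \<Rightarrow> hopf_alg" where
  "hopf_mon w = Poly_Mapping.single w 1"

definition hopf_t :: "int \<Rightarrow> hopf_alg" where
  "hopf_t m = hopf_mon (Tpow m)"

definition hopf_gen :: "hopf_gen \<Rightarrow> hopf_alg" where
  "hopf_gen g = hopf_mon (Gen 0 g (Tpow 0))"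

lemma hopf_mon_add: "hopf_mon (v + w) = hopf_mon v * hopf_mon w"
  by (simp add: hopf_mon_def mult_single)

lemma hopf_mon_0: "hopf_mon 0 = 1"
  by (simp add: hopf_mon_def)

lemma hopf_t_0: "hopf_t 0 = 1"
  by (simp add: hopf_t_def hopf_mon_0 flip: zero_hopf_word_def)

lemma hopf_t_add: "hopf_t (m + n) = hopf_t m * hopf_t n"
  by (simp add: hopf_t_def flip: hopf_mon_add)

lemma hopf_t_inverse: "hopf_t 1 * hopf_t (-1) = 1" "hopf_t (-1) * hopf_t 1 = 1"
  by (simp_all add: hopf_t_0 flip: hopf_t_add)

lemma hopf_mon_Tpow: "hopf_mon (Tpow m) = hopf_t m"
  by (simp add: hopf_t_def)

lemma hopf_mon_Gen: "hopf_mon (Gen m g w) = hopf_t m * hopf_gen g * hopf_mon w"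
proof -
  have "Tpow 0 + w = w" by (metis add_0 zero_hopf_word_def)
  then have "Gen m g w = Tpow m + Gen 0 g (Tpow 0) + w" by simp
  then show ?thesis by (simp only: hopf_mon_add hopf_t_def hopf_gen_def)
qed

lemma hopf_scalar_0: "hopf_scalar 0 = 0"
  and hopf_scalar_1: "hopf_scalar 1 = 1"
  and hopf_scalar_add: "hopf_scalar (c + e) = hopf_scalar c + hopf_scalar e"
  and hopf_scalar_mult: "hopf_scalar (c * e) = hopf_scalar c * hopf_scalar e"
  by (simp_all add: hopf_scalar_def single_add mult_single)

lemma single_eq_scalar_mon: "Poly_Mapping.single w c = hopf_scalar c * hopf_mon w"
  by (simp add: hopf_scalar_def hopf_mon_def mult_single)

lemma hopf_alg_induct [case_names zero add]:
  assumes "R 0" and "\<And>c w x. R x \<Longrightarrow> R (hopf_scalar c * hopf_mon w + x)"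
  shows "R (x :: hopf_alg)"
proof -
  have "R x" if "finite S" "Poly_Mapping.keys x \<subseteq> S" for S x
    using that
  proof (induction S arbitrary: x)
    case empty
    then show ?case using assms(1) by simp
  next
    case (insert w S)
    let ?y = "x - Poly_Mapping.single w (Poly_Mapping.lookup x w)"
    have "Poly_Mapping.keys ?y \<subseteq> S"
    proof
      fix v assume "v \<in> Poly_Mapping.keys ?y"
      then have "Poly_Mapping.lookup ?y v \<noteq> 0" by (simp add: in_keys_iff)
      then have "v \<noteq> w" "Poly_Mapping.lookup x v \<noteq> 0"
        by (cases "v = w"; simp add: lookup_minus lookup_single_not_eq)+
      then show "v \<in> S" using insert.prems by (auto simp: in_keys_iff)
    qed
    then have "R ?y" by (rule insert.IH)
    then have "R (Poly_Mapping.single w (Poly_Mapping.lookup x w) + ?y)"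
      unfolding single_eq_scalar_mon by (rule assms(2))
    then show ?case by simp
  qed
  then show ?thesis using finite_keys by blast
qed

lemma hopf_scalar_commute: "x * hopf_scalar c = hopf_scalar c * x"
proof (induction x rule: hopf_alg_induct)
  case (add e w x)
  have "(hopf_scalar e * hopf_mon w) * hopf_scalar c = hopf_scalar c * (hopf_scalar e * hopf_mon w)"
    by (simp add: hopf_scalar_def hopf_mon_def mult_single mult.commute)
  with add show ?case by (simp add: distrib_left distrib_right)
qed simp

section \<open>Grading and differential\<close>

fun gen_degree :: "hopf_gen \<Rightarrow> nat" where
  "gen_degree A1 = 1"
| "gen_degree A2 = 1"
| "gen_degree P = 0"
| "gen_degree Q = 0"

fun word_degree :: "hopf_word \<Rightarrow> nat" where
  "word_degree (Tpow m) = 0"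
| "word_degree (Gen m g w) = gen_degree g + word_degree w"

definition hopf_degree_part :: "int \<Rightarrow> hopf_alg set" where
  "hopf_degree_part n = {x. \<forall>w \<in> Poly_Mapping.keys x. int (word_degree w) = n}"

definition koszul_sign :: "int \<Rightarrow> hopf_alg" where
  "koszul_sign n = (if even n then 1 else - 1)"

definition is_hopf_differential :: "(hopf_alg \<Rightarrow> hopf_alg) \<Rightarrow> bool" where
  "is_hopf_differential d \<longleftrightarrow>
     (\<forall>x y. d (x + y) = d x + d y) \<and>
     (\<forall>c x. d (hopf_scalar c * x) = hopf_scalar c * d x) \<and>
     (\<forall>n. d ` hopf_degree_part n \<subseteq> hopf_degree_part (n - 1)) \<and>
     (\<forall>n. \<forall>x \<in> hopf_degree_part n. \<forall>y. d (x * y) = d x * y + koszul_sign n * x * d y) \<and>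
     d (hopf_gen P) = 0 \<and> d (hopf_gen Q) = 0 \<and> d (hopf_t 1) = 0 \<and> d (hopf_t (-1)) = 0 \<and>
     d (hopf_gen A1) = 1 - hopf_t 1 + hopf_gen Q * hopf_gen P \<and>
     d (hopf_gen A2) = 1 - hopf_t 1 + hopf_gen P * hopf_gen Q"

definition hopf_d :: "hopf_alg \<Rightarrow> hopf_alg" where
  "hopf_d = (THE d. is_hopf_differential d)"

subsection \<open>Existence and uniqueness of the differential\<close>

lemma word_degree_add: "word_degree (v + w) = word_degree v + word_degree w"
  by (induction v w rule: plus_hopf_word.induct) simp_all

lemma degree_part_0: "0 \<in> hopf_degree_part n"
  by (simp add: hopf_degree_part_def)

lemma degree_part_add:
  "x \<in> hopf_degree_part n \<Longrightarrow> y \<in> hopf_degree_part n \<Longrightarrow> x + y \<in> hopf_degree_part n"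
  using keys_add[of x y] by (auto simp: hopf_degree_part_def)

lemma degree_part_uminus: "x \<in> hopf_degree_part n \<Longrightarrow> - x \<in> hopf_degree_part n"
  by (auto simp: hopf_degree_part_def in_keys_iff)

lemma degree_part_mult:
  "x \<in> hopf_degree_part m \<Longrightarrow> y \<in> hopf_degree_part n \<Longrightarrow> x * y \<in> hopf_degree_part (m + n)"
  using keys_mult[of x y] by (force simp: hopf_degree_part_def word_degree_add)

lemma degree_part_scalar: "hopf_scalar c \<in> hopf_degree_part 0"
  by (auto simp: hopf_degree_part_def hopf_scalar_def zero_hopf_word_def)

lemma degree_part_mon: "hopf_mon w \<in> hopf_degree_part (int (word_degree w))"
  by (simp add: hopf_degree_part_def hopf_mon_def)

lemma degree_part_t: "hopf_t m \<in> hopf_degree_part 0"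
  using degree_part_mon[of "Tpow m"] by (simp add: hopf_t_def)

lemma degree_part_gen: "hopf_gen g \<in> hopf_degree_part (int (gen_degree g))"
  using degree_part_mon[of "Gen 0 g (Tpow 0)"] by (simp add: hopf_gen_def)

lemma degree_part_one: "1 \<in> hopf_degree_part 0"
  using degree_part_t[of 0] by (simp add: hopf_t_0)

lemma degree_part_sum:
  "(\<And>i. i \<in> I \<Longrightarrow> f i \<in> hopf_degree_part n) \<Longrightarrow> sum f I \<in> hopf_degree_part n"
  by (induction I rule: infinite_finite_induct) (auto intro: degree_part_0 degree_part_add)

lemma degree_part_koszul: "koszul_sign m * x \<in> hopf_degree_part n \<longleftrightarrow> x \<in> hopf_degree_part n"
  using degree_part_uminus[of x n] degree_part_uminus[of "- x" n] by (auto simp: koszul_sign_def)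

lemma koszul_sign_add: "koszul_sign (m + n) = koszul_sign m * koszul_sign n"
  by (auto simp: koszul_sign_def)

lemma koszul_sign_commute: "x * koszul_sign m = koszul_sign m * x"
  by (simp add: koszul_sign_def)

fun gen_d :: "hopf_gen \<Rightarrow> hopf_alg" where
  "gen_d A1 = 1 - hopf_t 1 + hopf_gen Q * hopf_gen P"
| "gen_d A2 = 1 - hopf_t 1 + hopf_gen P * hopf_gen Q"
| "gen_d P = 0"
| "gen_d Q = 0"

fun word_d :: "hopf_word \<Rightarrow> hopf_alg" where
  "word_d (Tpow m) = 0"
| "word_d (Gen m g w) = hopf_t m * gen_d g * hopf_mon w
     + koszul_sign (int (gen_degree g)) * (hopf_t m * hopf_gen g) * word_d w"

definition explicit_d :: "hopf_alg \<Rightarrow> hopf_alg" where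
  "explicit_d x =
     (\<Sum>w \<in> Poly_Mapping.keys x. hopf_scalar (Poly_Mapping.lookup x w) * word_d w)"

lemma gen_d_degree: "gen_d g \<in> hopf_degree_part (int (gen_degree g) - 1)"
proof -
  have "1 - hopf_t 1 + hopf_gen g * hopf_gen h \<in> hopf_degree_part 0"
    if "gen_degree g = 0" "gen_degree h = 0" for g h
    using degree_part_add[OF degree_part_add[OF degree_part_one degree_part_uminus[OF degree_part_t]]
        degree_part_mult[OF degree_part_gen degree_part_gen, of g h, unfolded that, simplified]]
    by simp
  then show ?thesis by (cases g) (simp_all add: degree_part_0)
qed

lemma word_d_degree: "word_d w \<in> hopf_degree_part (int (word_degree w) - 1)"
proof (induction w)
  case (Tpow m)
  then show ?case by (simp add: degree_part_0)
next
  case (Gen m g w)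
  have 1: "hopf_t m * gen_d g * hopf_mon w \<in> hopf_degree_part (int (word_degree (Gen m g w)) - 1)"
    using degree_part_mult[OF degree_part_mult[OF degree_part_t gen_d_degree] degree_part_mon, of m g w]
    by (simp add: algebra_simps)
  have "(hopf_t m * hopf_gen g) * word_d w \<in> hopf_degree_part (int (word_degree (Gen m g w)) - 1)"
    using degree_part_mult[OF degree_part_mult[OF degree_part_t degree_part_gen] Gen, of m g]
    by (simp add: algebra_simps)
  then have 2: "koszul_sign (int (gen_degree g)) * (hopf_t m * hopf_gen g) * word_d w
      \<in> hopf_degree_part (int (word_degree (Gen m g w)) - 1)"
    by (simp add: mult.assoc degree_part_koszul)
  show ?case using degree_part_add[OF 1 2] by simp
qed

lemma word_d_Tpow_add: "word_d (Tpow m + w) = hopf_t m * word_d w"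
proof (cases w)
  case (Gen n g v)
  have "hopf_t m * (koszul_sign k * x) = koszul_sign k * (hopf_t m * x)" for k x
    by (simp add: koszul_sign_def)
  with Gen show ?thesis by (simp add: hopf_t_add distrib_left mult.assoc)
qed simp

lemma word_d_add:
  "word_d (v + w) =
     word_d v * hopf_mon w + koszul_sign (int (word_degree v)) * hopf_mon v * word_d w"
proof (induction v)
  case (Tpow m)
  show ?case by (simp add: word_d_Tpow_add hopf_mon_Tpow koszul_sign_def)
next
  case (Gen m g v)
  let ?s = "koszul_sign (int (gen_degree g))" and ?r = "koszul_sign (int (word_degree v))"
  have "hopf_t m * hopf_gen g * (?r * x) = ?r * (hopf_t m * hopf_gen g * x)" for x
    by (simp add: koszul_sign_def)
  then show ?case
    by (simp add: Gen hopf_mon_Gen hopf_mon_add koszul_sign_add distrib_left distrib_right mult.assoc)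
qed

lemma explicit_d_superset:
  assumes "finite S" "Poly_Mapping.keys x \<subseteq> S"
  shows "explicit_d x = (\<Sum>w \<in> S. hopf_scalar (Poly_Mapping.lookup x w) * word_d w)"
  unfolding explicit_d_def
  by (rule sum.mono_neutral_left) (use assms in \<open>auto simp: in_keys_iff hopf_scalar_0\<close>)

lemma explicit_d_add: "explicit_d (x + y) = explicit_d x + explicit_d y"
proof -
  let ?S = "Poly_Mapping.keys x \<union> Poly_Mapping.keys y"
  have S: "finite ?S" by simp
  show ?thesis
    using explicit_d_superset[OF S, of x] explicit_d_superset[OF S, of y]
      explicit_d_superset[OF S keys_add]
    by (simp add: lookup_add hopf_scalar_add distrib_right sum.distrib)
qed

lemma explicit_d_mon: "explicit_d (hopf_mon w) = word_d w"
  by (simp add: explicit_d_def hopf_mon_def hopf_scalar_1)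

lemma explicit_d_0: "explicit_d 0 = 0"
  by (simp add: explicit_d_def)

lemma explicit_d_single: "explicit_d (hopf_scalar c * hopf_mon w) = hopf_scalar c * word_d w"
proof -
  have "explicit_d (Poly_Mapping.single w c) = hopf_scalar c * word_d w"
    by (cases "c = 0") (simp_all add: explicit_d_def hopf_scalar_0)
  then show ?thesis by (simp only: single_eq_scalar_mon)
qed

lemma explicit_d_scalar: "explicit_d (hopf_scalar c * x) = hopf_scalar c * explicit_d x"
proof (induction x rule: hopf_alg_induct)
  case zero
  then show ?case by (simp add: explicit_d_0)
next
  case (add e w x)
  have "explicit_d (hopf_scalar (c * e) * hopf_mon w)
      = hopf_scalar c * explicit_d (hopf_scalar e * hopf_mon w)"
    unfolding explicit_d_single by (simp add: hopf_scalar_mult mult.assoc)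
  then have "explicit_d (hopf_scalar c * (hopf_scalar e * hopf_mon w))
      = hopf_scalar c * explicit_d (hopf_scalar e * hopf_mon w)"
    by (simp add: hopf_scalar_mult mult.assoc)
  with add show ?case by (simp add: distrib_left explicit_d_add)
qed

lemma explicit_d_degree:
  assumes "x \<in> hopf_degree_part n"
  shows "explicit_d x \<in> hopf_degree_part (n - 1)"
  unfolding explicit_d_def
proof (rule degree_part_sum)
  fix w assume "w \<in> Poly_Mapping.keys x"
  with assms have "int (word_degree w) = n" by (simp add: hopf_degree_part_def)
  with degree_part_mult[OF degree_part_scalar word_d_degree, of _ w]
  show "hopf_scalar (Poly_Mapping.lookup x w) * word_d w \<in> hopf_degree_part (n - 1)" by simp
qed

lemma explicit_d_mon_mult:
  "explicit_d (hopf_mon v * y) =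
     word_d v * y + koszul_sign (int (word_degree v)) * hopf_mon v * explicit_d y"
proof (induction y rule: hopf_alg_induct)
  case zero
  then show ?case by (simp add: explicit_d_0)
next
  case (add c w y)
  have commute: "z * (hopf_scalar c * u) = hopf_scalar c * (z * u)" for z u
    by (simp add: hopf_scalar_commute flip: mult.assoc)
  have "hopf_mon v * (hopf_scalar c * hopf_mon w) = hopf_scalar c * hopf_mon (v + w)"
    by (simp add: commute hopf_mon_add)
  then have "explicit_d (hopf_mon v * (hopf_scalar c * hopf_mon w))
      = word_d v * (hopf_scalar c * hopf_mon w)
        + koszul_sign (int (word_degree v)) * hopf_mon v * explicit_d (hopf_scalar c * hopf_mon w)"
    by (simp only: explicit_d_single word_d_add commute distrib_left)
  with add show ?case by (simp add: distrib_left explicit_d_add)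
qed

lemma mon_expansion:
  "x = (\<Sum>w \<in> Poly_Mapping.keys x. hopf_scalar (Poly_Mapping.lookup x w) * hopf_mon w)"
proof (rule poly_mapping_eqI)
  fix v
  show "Poly_Mapping.lookup x v = Poly_Mapping.lookup
    (\<Sum>w \<in> Poly_Mapping.keys x. hopf_scalar (Poly_Mapping.lookup x w) * hopf_mon w) v"
    unfolding single_eq_scalar_mon[symmetric]
    by (simp add: lookup_sum lookup_single when_def in_keys_iff)
qed

lemma explicit_d_sum: "explicit_d (sum f I) = (\<Sum>i\<in>I. explicit_d (f i))"
  by (induction I rule: infinite_finite_induct) (simp_all add: explicit_d_0 explicit_d_add)

lemma explicit_d_leibniz:
  assumes "x \<in> hopf_degree_part n"
  shows "explicit_d (x * y) = explicit_d x * y + koszul_sign n * x * explicit_d y"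
proof -
  let ?K = "Poly_Mapping.keys x" and ?c = "\<lambda>w. hopf_scalar (Poly_Mapping.lookup x w)"
  have "explicit_d (x * y) = explicit_d (\<Sum>w\<in>?K. ?c w * (hopf_mon w * y))"
    by (subst (1) mon_expansion[of x]) (simp add: sum_distrib_right mult.assoc)
  also have "\<dots> = (\<Sum>w\<in>?K. ?c w * (word_d w * y + koszul_sign n * hopf_mon w * explicit_d y))"
    unfolding explicit_d_sum explicit_d_scalar explicit_d_mon_mult
    by (rule sum.cong) (use assms in \<open>auto simp: hopf_degree_part_def\<close>)
  also have "\<dots> = (\<Sum>w\<in>?K. ?c w * word_d w) * y
      + koszul_sign n * (\<Sum>w\<in>?K. ?c w * hopf_mon w) * explicit_d y"
    by (simp add: sum_distrib_right sum_distrib_left distrib_left sum.distrib mult.assoc)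
      (simp add: koszul_sign_def)
  finally show ?thesis by (simp flip: mon_expansion explicit_d_def)
qed

lemma is_hopf_differential_explicit_d: "is_hopf_differential explicit_d"
proof -
  have gen: "explicit_d (hopf_gen g) = gen_d g" for g
    by (simp add: hopf_gen_def explicit_d_mon hopf_t_0 hopf_mon_Tpow)
  show ?thesis
    unfolding is_hopf_differential_def
    by (intro conjI allI ballI)
      (auto simp: explicit_d_add explicit_d_scalar explicit_d_degree explicit_d_leibniz gen
        explicit_d_mon hopf_t_def)
qed

lemma is_hopf_differential_unique:
  assumes d: "is_hopf_differential d" and e: "is_hopf_differential e"
  shows "d = e"
proof
  have plus: "f (x + y) = f x + f y" and scal: "f (hopf_scalar c * x) = hopf_scalar c * f x"
    and leib: "x \<in> hopf_degree_part n \<Longrightarrow> f (x * y) = f x * y + koszul_sign n * x * f y"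
    if "is_hopf_differential f" for f c x y n
    using that unfolding is_hopf_differential_def by blast+
  have one: "f 1 = 0" if f: "is_hopf_differential f" for f
    using leib[OF f degree_part_one, of 1] by (simp add: koszul_sign_def)
  have gen: "d (hopf_gen g) = e (hopf_gen g)" for g
    using d e unfolding is_hopf_differential_def by (cases g) simp_all
  have t: "f (hopf_t m) = 0" if f: "is_hopf_differential f" for f m
  proof (induction m rule: int_induct[where k = 0])
    case base
    then show ?case using one[OF f] by (simp add: hopf_t_0)
  next
    case (step1 i)
    then show ?case
      using f leib[OF f degree_part_t] by (simp add: hopf_t_add is_hopf_differential_def)
  next
    case (step2 i)
    then show ?case
      using f leib[OF f degree_part_t] hopf_t_add[of i "-1"]
      by (simp add: is_hopf_differential_def)
  qed
  have mon: "d (hopf_mon w) = e (hopf_mon w)" for w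
  proof (induction w)
    case (Tpow m)
    then show ?case using t[OF d] t[OF e] by (simp add: hopf_mon_Tpow)
  next
    case (Gen m g w)
    then show ?case
      unfolding hopf_mon_Gen mult.assoc
      by (simp add: leib[OF d degree_part_t] leib[OF e degree_part_t]
          leib[OF d degree_part_gen] leib[OF e degree_part_gen] t[OF d] t[OF e] gen)
  qed
  fix x
  show "d x = e x"
  proof (induction x rule: hopf_alg_induct)
    case zero
    then show ?case using plus[OF d, of 0 0] plus[OF e, of 0 0] by simp
  next
    case (add c w x)
    then show ?case
      by (simp add: plus[OF d] plus[OF e] scal[OF d] scal[OF e] mon)
  qed
qed

lemma hopf_d_eq_explicit_d: "hopf_d = explicit_d"
  unfolding hopf_d_def
  using is_hopf_differential_explicit_d is_hopf_differential_unique by blast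

lemma is_hopf_differential_hopf_d: "is_hopf_differential hopf_d"
  by (simp add: hopf_d_eq_explicit_d is_hopf_differential_explicit_d)

lemma hopf_d_square: "hopf_d (hopf_d x) = 0"
proof -
  let ?d = explicit_d
  have gen0: "?d (hopf_gen g * hopf_gen h) = 0" if "gen_degree g = 0" "gen_degree h = 0" for g h
    using that explicit_d_leibniz[OF degree_part_gen, of g "hopf_gen h"]
    by (cases g; cases h)
      (simp_all add: hopf_gen_def explicit_d_mon hopf_t_0 hopf_mon_Tpow)
  have diff: "?d (x - y) = ?d x - ?d y" for x y
    using explicit_d_add[of "x - y" y] by (simp add: algebra_simps)
  have t: "?d (hopf_t m) = 0" for m by (simp add: hopf_t_def explicit_d_mon)
  have gen: "?d (gen_d g) = 0" for g
    using t[of 0] t[of 1]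
    by (cases g) (simp_all add: explicit_d_0 explicit_d_add diff gen0 hopf_t_0)
  have word: "?d (word_d w) = 0" for w
  proof (induction w)
    case (Tpow m)
    then show ?case by (simp add: explicit_d_0)
  next
    case (Gen m g w)
    let ?k = "int (gen_degree g)"
    have d_gen: "?d (hopf_gen g) = gen_d g"
      by (simp add: hopf_gen_def explicit_d_mon hopf_t_0 hopf_mon_Tpow)
    have 1: "?d (hopf_t m * (gen_d g * hopf_mon w)) =
        hopf_t m * (koszul_sign (?k - 1) * gen_d g * word_d w)"
      by (simp add: explicit_d_leibniz[OF degree_part_t] explicit_d_leibniz[OF gen_d_degree]
          t gen explicit_d_mon koszul_sign_def)
    have 2: "?d (hopf_t m * (hopf_gen g * word_d w)) = hopf_t m * (gen_d g * word_d w)"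
      by (simp add: explicit_d_leibniz[OF degree_part_t] explicit_d_leibniz[OF degree_part_gen]
          t d_gen Gen koszul_sign_def)
    have neg: "?d (- x) = - ?d x" for x using diff[of 0 x] by (simp add: explicit_d_0)
    have k: "?d (koszul_sign i * x) = koszul_sign i * ?d x" for i x
      by (simp add: koszul_sign_def neg)
    show ?case
      by (simp add: explicit_d_add mult.assoc k 1 2) (simp add: koszul_sign_def)
  qed
  have "?d (?d x) = 0"
    unfolding explicit_d_def[of x] explicit_d_sum explicit_d_scalar word by simp
  then show ?thesis by (simp add: hopf_d_eq_explicit_d)
qed

section \<open>Homology\<close>

definition hopf_cycles :: "hopf_alg set" where
  "hopf_cycles = {x. hopf_d x = 0}"

definition hopf_boundaries :: "hopf_alg set" where
  "hopf_boundaries = hopf_d ` UNIV"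

definition hopf_cycle_ring :: "hopf_alg ring" where
  "hopf_cycle_ring = ring_of_type_algebra\<lparr>carrier := hopf_cycles\<rparr>"

definition hopf_homology :: "hopf_alg set ring" where
  "hopf_homology = hopf_cycle_ring Quot hopf_boundaries"

definition homology_class :: "hopf_alg \<Rightarrow> hopf_alg set" where
  "homology_class x = hopf_boundaries +>\<^bsub>hopf_cycle_ring\<^esub> x"

definition homology_degree_part :: "int \<Rightarrow> hopf_alg set set" where
  "homology_degree_part n = homology_class ` (hopf_cycles \<inter> hopf_degree_part n)"

section \<open>Localization\<close>

text \<open>
  Localization of a commutative ring (given as a type) at a multiplicative system \<open>S\<close>; a fraction
  is an equivalence class of pairs of a numerator and a denominator. \<open>S\<close> is expected to be closed
  under multiplication and to contain \<open>1\<close>.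
\<close>

definition localization_rel :: "'a::comm_ring_1 set \<Rightarrow> (('a \<times> 'a) \<times> ('a \<times> 'a)) set" where
  "localization_rel S =
     {((a, s), (b, t)) | a s b t. s \<in> S \<and> t \<in> S \<and> (\<exists>u \<in> S. u * (a * t - b * s) = 0)}"

definition fraction :: "'a::comm_ring_1 set \<Rightarrow> 'a \<Rightarrow> 'a \<Rightarrow> ('a \<times> 'a) set" where
  "fraction S a s = localization_rel S `` {(a, s)}"

definition localization :: "'a::comm_ring_1 set \<Rightarrow> ('a \<times> 'a) set ring" where
  "localization S =
     \<lparr>carrier = (UNIV \<times> S) // localization_rel S,
      monoid.mult = (\<lambda>x y. \<Union>(a, s) \<in> x. \<Union>(b, t) \<in> y. fraction S (a * b) (s * t)),
      one = fraction S 1 1,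
      ring.zero = fraction S 0 1,
      add = (\<lambda>x y. \<Union>(a, s) \<in> x. \<Union>(b, t) \<in> y. fraction S (a * t + b * s) (s * t))\<rparr>"

lemma localization_rel_equiv:
  assumes one: "1 \<in> S" and mult: "\<And>s t. s \<in> S \<Longrightarrow> t \<in> S \<Longrightarrow> s * t \<in> S"
  shows "equiv (UNIV \<times> S) (localization_rel S)"
proof (rule equivI)
  show "localization_rel S \<subseteq> (UNIV \<times> S) \<times> (UNIV \<times> S)"
    by (auto simp: localization_rel_def)
  show "refl_on (UNIV \<times> S) (localization_rel S)"
    using one by (auto simp: refl_on_def localization_rel_def)
  show "sym (localization_rel S)"
  proof (rule symI)
    fix x y assume "(x, y) \<in> localization_rel S"
    then obtain a s b t u where xy: "x = (a, s)" "y = (b, t)" "s \<in> S" "t \<in> S" "u \<in> S"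
      and u: "u * (a * t - b * s) = 0"
      unfolding localization_rel_def by blast
    from u have "u * (b * s - a * t) = 0" by (simp add: algebra_simps)
    with xy show "(y, x) \<in> localization_rel S" unfolding localization_rel_def by blast
  qed
  show "trans (localization_rel S)"
  proof (rule transI)
    fix x y z assume "(x, y) \<in> localization_rel S" "(y, z) \<in> localization_rel S"
    then obtain a s b t c r u v where xy: "x = (a, s)" "y = (b, t)" "z = (c, r)"
        "s \<in> S" "t \<in> S" "r \<in> S" "u \<in> S" "v \<in> S"
      and u: "u * (a * t - b * s) = 0" and v: "v * (b * r - c * t) = 0"
      unfolding localization_rel_def by blast
    have "u * v * t * (a * r - c * s)
        = v * r * (u * (a * t - b * s)) + u * s * (v * (b * r - c * t))"
      by (simp add: algebra_simps)
    with u v have "u * v * t * (a * r - c * s) = 0" by simp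
    moreover have "u * v * t \<in> S" using xy mult by blast
    ultimately show "(x, z) \<in> localization_rel S"
      using xy unfolding localization_rel_def by blast
  qed
qed

lemma fraction_mult:
  fixes S :: "'a::comm_ring_1 set"
  assumes one: "1 \<in> S" and mult: "\<And>s t. s \<in> S \<Longrightarrow> t \<in> S \<Longrightarrow> s * t \<in> S"
    and s: "s \<in> S" "t \<in> S"
  shows "fraction S a s \<otimes>\<^bsub>localization S\<^esub> fraction S b t = fraction S (a * b) (s * t)"
proof -
  note eq = localization_rel_equiv[OF one mult]
  have "(\<lambda>(a, s) (b, t). fraction S (a * b) (s * t)) respects2 localization_rel S"
  proof (rule congruent2_commuteI[OF eq])
    fix y z :: "'a \<times> 'a" assume "y \<in> UNIV \<times> S" "z \<in> UNIV \<times> S"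
    then show "(case y of (a, s) \<Rightarrow> \<lambda>(b, t). fraction S (a * b) (s * t)) z
        = (case z of (a, s) \<Rightarrow> \<lambda>(b, t). fraction S (a * b) (s * t)) y"
      by (auto simp: mult.commute)
  next
    fix y z w :: "'a \<times> 'a" assume w: "w \<in> UNIV \<times> S" and yz: "(y, z) \<in> localization_rel S"
    obtain a s b t u where y: "y = (a, s)" "z = (b, t)" "s \<in> S" "t \<in> S" "u \<in> S"
      and u: "u * (a * t - b * s) = 0"
      using yz unfolding localization_rel_def by blast
    obtain c r where r: "w = (c, r)" "r \<in> S" using w by auto
    have "u * (c * a * (r * t) - c * b * (r * s)) = c * r * (u * (a * t - b * s))"
      by (simp add: algebra_simps)
    with u have "u * (c * a * (r * t) - c * b * (r * s)) = 0" by simp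
    then have "((c * a, r * s), (c * b, r * t)) \<in> localization_rel S"
      using y r mult unfolding localization_rel_def by blast
    then show "(case w of (a, s) \<Rightarrow> \<lambda>(b, t). fraction S (a * b) (s * t)) y
        = (case w of (a, s) \<Rightarrow> \<lambda>(b, t). fraction S (a * b) (s * t)) z"
      unfolding y r fraction_def by (simp add: equiv_class_eq[OF eq])
  qed simp_all
  from UN_equiv_class2[OF eq eq this, of "(a, s)" "(b, t)"] s
  show ?thesis by (simp add: localization_def fraction_def case_prod_beta)
qed

lemma fraction_add:
  fixes S :: "'a::comm_ring_1 set"
  assumes one: "1 \<in> S" and mult: "\<And>s t. s \<in> S \<Longrightarrow> t \<in> S \<Longrightarrow> s * t \<in> S"
    and s: "s \<in> S" "t \<in> S"
  shows "fraction S a s \<oplus>\<^bsub>localization S\<^esub> fraction S b t = fraction S (a * t + b * s) (s * t)"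
proof -
  note eq = localization_rel_equiv[OF one mult]
  have "(\<lambda>(a, s) (b, t). fraction S (a * t + b * s) (s * t)) respects2 localization_rel S"
  proof (rule congruent2_commuteI[OF eq])
    fix y z :: "'a \<times> 'a" assume "y \<in> UNIV \<times> S" "z \<in> UNIV \<times> S"
    then show "(case y of (a, s) \<Rightarrow> \<lambda>(b, t). fraction S (a * t + b * s) (s * t)) z
        = (case z of (a, s) \<Rightarrow> \<lambda>(b, t). fraction S (a * t + b * s) (s * t)) y"
      by (auto simp: mult.commute add.commute)
  next
    fix y z w :: "'a \<times> 'a" assume w: "w \<in> UNIV \<times> S" and yz: "(y, z) \<in> localization_rel S"
    obtain a s b t u where y: "y = (a, s)" "z = (b, t)" "s \<in> S" "t \<in> S" "u \<in> S"
      and u: "u * (a * t - b * s) = 0"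
      using yz unfolding localization_rel_def by blast
    obtain c r where r: "w = (c, r)" "r \<in> S" using w by auto
    have "u * ((c * s + a * r) * (r * t) - (c * t + b * r) * (r * s))
        = r * r * (u * (a * t - b * s))"
      by (simp add: algebra_simps)
    with u have "u * ((c * s + a * r) * (r * t) - (c * t + b * r) * (r * s)) = 0" by simp
    then have "((c * s + a * r, r * s), (c * t + b * r, r * t)) \<in> localization_rel S"
      using y r mult unfolding localization_rel_def by blast
    then show "(case w of (a, s) \<Rightarrow> \<lambda>(b, t). fraction S (a * t + b * s) (s * t)) y
        = (case w of (a, s) \<Rightarrow> \<lambda>(b, t). fraction S (a * t + b * s) (s * t)) z"
      unfolding y r fraction_def by (simp add: equiv_class_eq[OF eq])
  qed simp_all
  from UN_equiv_class2[OF eq eq this, of "(a, s)" "(b, t)"] s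
  show ?thesis by (simp add: localization_def fraction_def case_prod_beta)
qed

text \<open>\<open>\<complex>[p,q]\<close> is represented as \<open>\<complex>[p][q]\<close>: the outer variable is \<open>q\<close>.
  The exponent \<open>0\<close> is allowed in a denominator so that \<open>f/1\<close> is a fraction; this does not change
  the localization.\<close>

definition poly_p :: "complex poly poly" where
  "poly_p = [:[:0, 1:]:]"

definition poly_q :: "complex poly poly" where
  "poly_q = [:0, 1:]"

definition hopf_denominators :: "complex poly poly set" where
  "hopf_denominators = {(1 + poly_p * poly_q) ^ n | n. True}"

lemma hopf_denominators_one: "1 \<in> hopf_denominators"
  unfolding hopf_denominators_def by (metis (mono_tags, lifting) mem_Collect_eq power_0)

lemma hopf_denominators_mult:
  "s \<in> hopf_denominators \<Longrightarrow> t \<in> hopf_denominators \<Longrightarrow> s * t \<in> hopf_denominators"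
  unfolding hopf_denominators_def by (auto simp flip: power_add)

definition hopf_localization :: "(complex poly poly \<times> complex poly poly) set ring" where
  "hopf_localization = localization hopf_denominators"

definition hopf_frac :: "complex poly poly \<Rightarrow> (complex poly poly \<times> complex poly poly) set" where
  "hopf_frac f = fraction hopf_denominators f 1"

section \<open>Smooth affine algebras over the complex numbers\<close>

abbreviation complex_ring :: "complex ring" where
  "complex_ring \<equiv> ring_of_type_algebra"

definition complex_cring_algebra :: "'b ring \<Rightarrow> (complex \<Rightarrow> 'b) \<Rightarrow> bool" where
  "complex_cring_algebra R \<iota> \<longleftrightarrow> cring R \<and> \<iota> \<in> ring_hom complex_ring R"

definition affine_algebra :: "'a ring \<Rightarrow> (complex \<Rightarrow> 'a) \<Rightarrow> bool" where
  "affine_algebra R \<iota> \<longleftrightarrow> complex_cring_algebra R \<iota> \<and>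
     (\<exists>G. finite G \<and> G \<subseteq> carrier R \<and> generate_ring R (\<iota> ` UNIV \<union> G) = carrier R)"

text \<open>
  Infinitesimal lifting: every algebra homomorphism from \<open>R\<close> to \<open>B/I\<close>, where \<open>I\<close> is an ideal of
  square zero in a commutative complex algebra \<open>B\<close>, lifts to \<open>B\<close>. As HOL cannot quantify over
  types, the type that carries \<open>B\<close> is a parameter, and it is universally quantified by being
  left as a type variable in a theorem.
\<close>

definition formally_smooth :: "'b itself \<Rightarrow> 'a ring \<Rightarrow> (complex \<Rightarrow> 'a) \<Rightarrow> bool" where
  "formally_smooth (_ :: 'b itself) R \<iota> \<longleftrightarrow>
     (\<forall>(B :: 'b ring) \<beta> I f.
        complex_cring_algebra B \<beta> \<longrightarrow>
        ideal I B \<longrightarrow>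
        (\<forall>x \<in> I. \<forall>y \<in> I. x \<otimes>\<^bsub>B\<^esub> y = \<zero>\<^bsub>B\<^esub>) \<longrightarrow>
        f \<in> ring_hom R (B Quot I) \<longrightarrow>
        (\<forall>c. f (\<iota> c) = I +>\<^bsub>B\<^esub> \<beta> c) \<longrightarrow>
        (\<exists>g \<in> ring_hom R B. (\<forall>c. g (\<iota> c) = \<beta> c) \<and> (\<forall>x \<in> carrier R. I +>\<^bsub>B\<^esub> g x = f x)))"

text \<open>
  Smooth means formally smooth and of finite presentation; over a field the latter is the same
  as finite type.
\<close>

definition smooth_affine_algebra :: "'b itself \<Rightarrow> 'a ring \<Rightarrow> (complex \<Rightarrow> 'a) \<Rightarrow> bool" where
  "smooth_affine_algebra B R \<iota> \<longleftrightarrow> affine_algebra R \<iota> \<and> formally_smooth B R \<iota>"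

end

theory Submission
  imports Defs
begin

text \<open>
  Let \<open>R = \<complex>[p,q][t\<^sup>-\<^sup>1]\<close> with \<open>t = 1 + pq\<close>, in degree zero. Sending \<open>a1\<close> and \<open>a2\<close> to \<open>0\<close> defines a map
  of dg-algebras \<open>ev\<close> from the Chekanov-Eliashberg algebra \<open>A\<close> to \<open>R\<close>, because \<open>1 - t + qp\<close> and
  \<open>1 - t + pq\<close> vanish in \<open>R\<close>, and \<open>ev\<close> is onto already in degree zero. The theorem says
  that \<open>ev\<close> is a quasi-isomorphism. The abstract reason is that \<open>a1 - a2\<close>, whose differential is
  \<open>qp - pq\<close>, resolves \<open>\<complex>[p,q]\<close> over the free algebra on \<open>p\<close> and \<open>q\<close>, while \<open>a2\<close> and \<open>t\<close> adjoin an
  inverse of \<open>1 + pq\<close> in the derived sense; the derived localization of a commutative ring at one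
  element is the usual one.

  The proof makes this explicit by a contraction of \<open>A\<close> onto \<open>R\<close>: a linear section \<open>\<sigma>\<close> of \<open>ev\<close> with
  values in degree zero, and a linear map \<open>h\<close> of degree \<open>1\<close> such that
  \<open>d h + h d = 1 - \<sigma> ev\<close>
  (lemma \<open>contraction\<close>). A cycle in the kernel of \<open>ev\<close> is then the boundary of its image under \<open>h\<close>.

  As a vector space \<open>R\<close> has the basis \<open>p\<^sup>i t\<^sup>m\<close>, \<open>q\<^sup>j t\<^sup>m\<close>, and \<open>\<sigma>\<close> sends these elements to the words
  with the same names. The homotopy is a twisted derivation: for a letter \<open>g\<close>,
  \<open>h(g x) = \<plusminus> g h(x) + H_g(ev(x))\<close>,
  where \<open>H_g : R \<rightarrow> A\<close> measures the failure of \<open>\<sigma>\<close> to commute with \<open>g\<close>, that is,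
  \<open>d(H_g(r)) = g \<sigma>(r) - \<sigma>(g r)\<close> for \<open>g\<close> of degree zero. For \<open>g = a1, a2\<close> the choice \<open>H_g = 0\<close> works
  if and only if \<open>h(d(a_i) x) = d(a_i) h(x) + a_i \<sigma>(ev(x))\<close>. As \<open>t\<close> occurs linearly in \<open>d(a_i)\<close>,
  each of these two equations can be solved for \<open>H_t\<close>, and the two solutions agree precisely if
  \<open>p H_q(r) + H_p(q r) - q H_p(r) - H_q(p r) = (a2 - a1) \<sigma>(r)\<close>.
  Together with \<open>H_p(p\<^sup>i) = 0 = H_q(q\<^sup>j)\<close> this is a recursion for \<open>H_p(q\<^sup>j)\<close> and \<open>H_q(p\<^sup>i)\<close>, and its
  solutions with \<open>H_p(q) = a2\<close>, \<open>H_q(p) = a1\<close> (\<open>p_chain\<close> and \<open>q_chain\<close>) also satisfy the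
  boundary conditions. There is no condition on the inverse of \<open>t\<close>,
  since \<open>H\<close> of an inverse letter is determined by \<open>H\<close> of the letter.

  Smoothness is a general fact about localizations of polynomial rings: a homomorphism to \<open>B/I\<close> is
  lifted by choosing preimages of \<open>p\<close> and \<open>q\<close>, and the image of \<open>1 + pq\<close> is a unit of \<open>B\<close>
  because it is one modulo an ideal of square zero.
\<close>

section \<open>Linear maps out of the algebra and out of the polynomials\<close>

definition word_lin :: "(complex \<Rightarrow> 'c::ring_1) \<Rightarrow> (hopf_word \<Rightarrow> 'c) \<Rightarrow> hopf_alg \<Rightarrow> 'c" where
  "word_lin \<iota> \<phi> x = (\<Sum>w \<in> Poly_Mapping.keys x. \<iota> (Poly_Mapping.lookup x w) * \<phi> w)"

lemma word_lin_superset: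
  assumes "\<iota> 0 = 0" "finite S" "Poly_Mapping.keys x \<subseteq> S"
  shows "word_lin \<iota> \<phi> x = (\<Sum>w \<in> S. \<iota> (Poly_Mapping.lookup x w) * \<phi> w)"
  unfolding word_lin_def
  by (rule sum.mono_neutral_left) (use assms in \<open>auto simp: in_keys_iff\<close>)

lemma word_lin_add:
  assumes "\<iota> 0 = 0" "\<And>a b. \<iota> (a + b) = \<iota> a + \<iota> b"
  shows "word_lin \<iota> \<phi> (x + y) = word_lin \<iota> \<phi> x + word_lin \<iota> \<phi> y"
proof -
  let ?S = "Poly_Mapping.keys x \<union> Poly_Mapping.keys y"
  have S: "finite ?S" by simp
  show ?thesis
    using word_lin_superset[of \<iota>, OF assms(1) S, of x] word_lin_superset[of \<iota>, OF assms(1) S, of y]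
      word_lin_superset[of \<iota>, OF assms(1) S keys_add]
    by (simp add: lookup_add assms(2) distrib_right sum.distrib)
qed

lemma word_lin_single:
  assumes "\<iota> 0 = 0"
  shows "word_lin \<iota> \<phi> (hopf_scalar c * hopf_mon w) = \<iota> c * \<phi> w"
  by (cases "c = 0") (simp_all add: word_lin_def assms flip: single_eq_scalar_mon)

lemma word_lin_0: "word_lin \<iota> \<phi> 0 = 0"
  by (simp add: word_lin_def)

lemma word_lin_mon: "\<iota> 0 = 0 \<Longrightarrow> \<iota> 1 = 1 \<Longrightarrow> word_lin \<iota> \<phi> (hopf_mon w) = \<phi> w"
  using word_lin_single[of \<iota> \<phi> 1 w] by (simp add: hopf_scalar_1)

text \<open>
  The coefficients are allowed to be polynomials again, so that an additive map out of \<open>\<complex>[p][q]\<close> is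
  obtained by using this twice.
\<close>

definition coeff_sum :: "(nat \<Rightarrow> 'c::zero \<Rightarrow> 'd::comm_monoid_add) \<Rightarrow> 'c poly \<Rightarrow> 'd" where
  "coeff_sum g f = (\<Sum>j\<le>degree f. g j (coeff f j))"

lemma coeff_sum_bound:
  assumes "\<And>j. g j 0 = 0" "degree f \<le> n"
  shows "coeff_sum g f = (\<Sum>j\<le>n. g j (coeff f j))"
  unfolding coeff_sum_def
  by (rule sum.mono_neutral_left) (use assms in \<open>auto simp: coeff_eq_0\<close>)

lemma coeff_sum_add:
  fixes f f' :: "'c::comm_monoid_add poly"
  assumes "\<And>j. g j 0 = 0" "\<And>j a b. g j (a + b) = g j a + g j b"
  shows "coeff_sum g (f + f') = coeff_sum g f + coeff_sum g f'"
proof -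
  let ?n = "max (degree f) (degree f')"
  have "degree (f + f') \<le> ?n" by (rule degree_add_le_max)
  then show ?thesis
    using coeff_sum_bound[of g f ?n] coeff_sum_bound[of g f' ?n] coeff_sum_bound[of g "f + f'" ?n]
    by (simp add: assms sum.distrib)
qed

lemma coeff_sum_pCons:
  assumes "\<And>j. g j 0 = 0"
  shows "coeff_sum g (pCons a f) = g 0 a + coeff_sum (\<lambda>j. g (Suc j)) f"
proof -
  have "coeff_sum g (pCons a f) = (\<Sum>j\<le>Suc (degree f). g j (coeff (pCons a f) j))"
    by (rule coeff_sum_bound) (simp_all add: assms degree_pCons_le)
  also have "\<dots> = g 0 a + (\<Sum>j\<le>degree f. g (Suc j) (coeff f j))"
    by (subst sum.atMost_Suc_shift) simp
  finally show ?thesis by (simp add: coeff_sum_def)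
qed

lemma coeff_sum_map:
  assumes "\<And>j. g j 0 = 0" "\<And>j a. coeff f' j = u (coeff f j)" "u 0 = 0"
  shows "coeff_sum g f' = coeff_sum (\<lambda>j a. g j (u a)) f"
proof -
  have "degree f' \<le> degree f"
    by (rule degree_le) (simp add: assms coeff_eq_0)
  then show ?thesis
    using coeff_sum_bound[of g f' "degree f"] assms by (simp add: coeff_sum_def)
qed

text \<open>
  The complex-linear map \<open>\<complex>[p,q] \<rightarrow> A\<close> with \<open>p\<^sup>i q\<^sup>j \<mapsto> \<phi> i j\<close>. Multiplication by \<open>p\<close> or \<open>q\<close> in the source
  becomes a shift of an index, so identities between such maps reduce to identities between the
  families \<open>\<phi>\<close>.
\<close>

definition poly_lin :: "(nat \<Rightarrow> nat \<Rightarrow> hopf_alg) \<Rightarrow> complex poly poly \<Rightarrow> hopf_alg" where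
  "poly_lin \<phi> = coeff_sum (\<lambda>j. coeff_sum (\<lambda>i c. hopf_scalar c * \<phi> i j))"

lemma poly_lin_inner_0: "coeff_sum (\<lambda>i c. hopf_scalar c * \<phi> i j) 0 = 0"
  by (simp add: coeff_sum_def hopf_scalar_0)

lemma poly_lin_add: "poly_lin \<phi> (f + g) = poly_lin \<phi> f + poly_lin \<phi> g"
  unfolding poly_lin_def
  by (intro coeff_sum_add) (simp_all add: poly_lin_inner_0 hopf_scalar_0 hopf_scalar_add distrib_right)

lemma poly_lin_p: "poly_lin \<phi> (f * poly_p) = poly_lin (\<lambda>i j. \<phi> (Suc i) j) f"
proof -
  have "coeff_sum (\<lambda>i c. hopf_scalar c * \<phi> i j) (pCons 0 a)
      = coeff_sum (\<lambda>i c. hopf_scalar c * \<phi> (Suc i) j) a" for j a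
    by (subst coeff_sum_pCons) (simp_all add: hopf_scalar_0)
  moreover have "coeff (f * poly_p) j = pCons 0 (coeff f j)" for j
    by (simp add: poly_p_def mult.commute[of _ "[:[:0, 1:]:]"])
  ultimately show ?thesis
    unfolding poly_lin_def
    by (subst coeff_sum_map[where u = "pCons 0" and f = f]) (simp_all add: poly_lin_inner_0)
qed

lemma poly_lin_q: "poly_lin \<phi> (f * poly_q) = poly_lin (\<lambda>i j. \<phi> i (Suc j)) f"
  unfolding poly_lin_def
  by (simp add: poly_q_def mult.commute[of _ "[:0, 1:]"])
    (subst coeff_sum_pCons, simp_all add: poly_lin_inner_0)

lemma poly_lin_const: "poly_lin \<phi> [:[:c:]:] = hopf_scalar c * \<phi> 0 0"
  by (simp add: poly_lin_def coeff_sum_def)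

lemma poly_lin_scalar: "poly_lin \<phi> (f * [:[:c:]:]) = hopf_scalar c * poly_lin \<phi> f"
proof -
  have "coeff_sum (\<lambda>i c. hopf_scalar c * \<phi> i j) (smult c a)
      = hopf_scalar c * coeff_sum (\<lambda>i c. hopf_scalar c * \<phi> i j) a" for j a
    by (subst coeff_sum_map[where u = "(*) c" and f = a])
      (simp_all add: hopf_scalar_0 hopf_scalar_mult mult.assoc coeff_sum_def sum_distrib_left)
  moreover have "coeff (f * [:[:c:]:]) j = smult c (coeff f j)" for j
    by (simp add: mult.commute[of _ "[:[:c:]:]"])
  ultimately show ?thesis
    unfolding poly_lin_def
    by (subst coeff_sum_map[where u = "smult c" and f = f])
      (simp_all add: poly_lin_inner_0, simp add: coeff_sum_def sum_distrib_left)
qed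

lemma poly_lin_plus_index:
  "poly_lin (\<lambda>i j. \<phi> i j + \<psi> i j) f = poly_lin \<phi> f + poly_lin \<psi> f"
  by (simp add: poly_lin_def coeff_sum_def distrib_left sum.distrib)

lemma poly_lin_minus_index:
  "poly_lin (\<lambda>i j. \<phi> i j - \<psi> i j) f = poly_lin \<phi> f - poly_lin \<psi> f"
  by (simp add: poly_lin_def coeff_sum_def right_diff_distrib sum_subtractf)

lemma poly_lin_left_index: "poly_lin (\<lambda>i j. x * \<phi> i j) f = x * poly_lin \<phi> f"
proof -
  have "hopf_scalar c * (x * y) = x * (hopf_scalar c * y)" for c y
    by (metis hopf_scalar_commute mult.assoc)
  then show ?thesis by (simp add: poly_lin_def coeff_sum_def sum_distrib_left)
qed

lemma poly_lin_right_index: "poly_lin (\<lambda>i j. \<phi> i j * x) f = poly_lin \<phi> f * x"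
  by (simp add: poly_lin_def coeff_sum_def sum_distrib_right mult.assoc)

lemma explicit_d_poly_lin: "explicit_d (poly_lin \<phi> f) = poly_lin (\<lambda>i j. explicit_d (\<phi> i j)) f"
  by (simp add: poly_lin_def coeff_sum_def explicit_d_sum explicit_d_scalar)

section \<open>The localization inside the field of fractions\<close>

abbreviation frac_p :: "complex poly poly fract" where "frac_p \<equiv> to_fract poly_p"
abbreviation frac_q :: "complex poly poly fract" where "frac_q \<equiv> to_fract poly_q"
abbreviation frac_t :: "complex poly poly fract" where "frac_t \<equiv> to_fract (1 + poly_p * poly_q)"

lemma one_plus_pq_nonzero: "1 + poly_p * poly_q \<noteq> 0"
proof
  assume "1 + poly_p * poly_q = 0"
  then have "poly (1 + poly_p * poly_q) 0 = 0" by simp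
  then show False by (simp add: poly_q_def poly_p_def)
qed

lemma frac_t_nonzero: "frac_t \<noteq> 0"
  by (simp only: to_fract_eq_0_iff one_plus_pq_nonzero not_False_eq_True)

text \<open>
  The localization is realized inside the field of fractions of \<open>\<complex>[p,q]\<close>: there equality of
  fractions is decided by cross-multiplication, and field arithmetic is available.
\<close>

definition loc_fractions :: "complex poly poly fract set" where
  "loc_fractions = {to_fract f / frac_t ^ n | f n. True}"

lemma loc_fractions_cases:
  assumes "r \<in> loc_fractions"
  obtains f n where "r = to_fract f / frac_t ^ n"
  using assms unfolding loc_fractions_def by blast

lemma to_fract_power: "to_fract (f ^ n) = to_fract f ^ n"
  by (induction n) simp_all

lemma loc_fractions_add: "r \<in> loc_fractions \<Longrightarrow> r' \<in> loc_fractions \<Longrightarrow> r + r' \<in> loc_fractions"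
proof -
  assume "r \<in> loc_fractions" "r' \<in> loc_fractions"
  then obtain f n f' n' where r: "r = to_fract f / frac_t ^ n" "r' = to_fract f' / frac_t ^ n'"
    by (metis loc_fractions_cases)
  have "r + r' = to_fract (f * (1 + poly_p * poly_q) ^ n' + f' * (1 + poly_p * poly_q) ^ n)
      / frac_t ^ (n + n')"
    using frac_t_nonzero unfolding r by (simp only: to_fract_add to_fract_mult to_fract_power
      add_frac_eq power_not_zero not_False_eq_True power_add)
  then show ?thesis unfolding loc_fractions_def by blast
qed

lemma loc_fractions_mult: "r \<in> loc_fractions \<Longrightarrow> r' \<in> loc_fractions \<Longrightarrow> r * r' \<in> loc_fractions"
proof -
  assume "r \<in> loc_fractions" "r' \<in> loc_fractions"
  then obtain f n f' n' where r: "r = to_fract f / frac_t ^ n" "r' = to_fract f' / frac_t ^ n'"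
    by (metis loc_fractions_cases)
  have "r * r' = to_fract (f * f') / frac_t ^ (n + n')"
    unfolding r by (simp only: to_fract_mult power_add times_divide_times_eq)
  then show ?thesis unfolding loc_fractions_def by blast
qed

lemma loc_fractions_to_fract: "to_fract f \<in> loc_fractions"
proof -
  have "to_fract f = to_fract f / frac_t ^ 0" by simp
  then show ?thesis unfolding loc_fractions_def by blast
qed

lemma loc_fractions_t: "frac_t powi m \<in> loc_fractions"
proof (cases "m \<ge> 0")
  case True
  then have "frac_t powi m = to_fract ((1 + poly_p * poly_q) ^ nat m)"
    by (simp only: to_fract_power power_int_def if_True)
  then show ?thesis by (simp only: loc_fractions_to_fract)
next
  case False
  then have "frac_t powi m = to_fract 1 / frac_t ^ nat (- m)"
    by (simp only: power_int_def if_False to_fract_1 power_inverse) (simp only: divide_inverse mult_1)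
  then show ?thesis unfolding loc_fractions_def by blast
qed

lemma loc_fractions_0: "0 \<in> loc_fractions" using loc_fractions_to_fract[of 0] by simp
lemma loc_fractions_1: "1 \<in> loc_fractions" using loc_fractions_to_fract[of 1] by simp

lemmas loc_fractions_closed =
  loc_fractions_add loc_fractions_mult loc_fractions_to_fract loc_fractions_t
  loc_fractions_0 loc_fractions_1

text \<open>
  The condition says that \<open>f pq\<close> is sent to the image of \<open>f\<close> times \<open>t - 1\<close>, that is, that the linear
  map is equivariant for right multiplication by \<open>t = 1 + pq\<close>. As \<open>t\<close> is invertible in \<open>A\<close>, such a
  map extends uniquely to the localization.
\<close>

definition t_equivariant :: "(nat \<Rightarrow> nat \<Rightarrow> hopf_alg) \<Rightarrow> bool" where
  "t_equivariant \<phi> \<longleftrightarrow> (\<forall>i j. \<phi> (Suc i) (Suc j) = \<phi> i j * (hopf_t 1 - 1))"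

lemma poly_lin_t:
  assumes "t_equivariant \<phi>"
  shows "poly_lin \<phi> (f * (1 + poly_p * poly_q) ^ n) = poly_lin \<phi> f * hopf_t (int n)"
proof (induction n arbitrary: f)
  case 0
  then show ?case by (simp add: hopf_t_0)
next
  case (Suc n)
  have "poly_lin \<phi> (f * (1 + poly_p * poly_q)) = poly_lin \<phi> f + poly_lin \<phi> (f * poly_q * poly_p)"
    by (simp add: poly_lin_add distrib_left mult_ac)
  also have "\<dots> = poly_lin \<phi> f * hopf_t 1"
    using assms unfolding t_equivariant_def
    by (simp add: poly_lin_p poly_lin_q poly_lin_right_index flip: mult.assoc) (simp add: right_diff_distrib)
  finally have "poly_lin \<phi> (f * (1 + poly_p * poly_q)) = poly_lin \<phi> f * hopf_t 1" .
  with Suc[of "f * (1 + poly_p * poly_q)"] show ?case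
    by (simp add: mult.assoc flip: hopf_t_add)
qed

text \<open>
  The extension sends \<open>f / t\<^sup>n\<close> to the image of \<open>f\<close> times \<open>t\<^sup>-\<^sup>n\<close>; for a family that is
  \<open>t\<close>-equivariant this does not depend on the representation of the fraction.
\<close>

definition loc_lin :: "(nat \<Rightarrow> nat \<Rightarrow> hopf_alg) \<Rightarrow> complex poly poly fract \<Rightarrow> hopf_alg" where
  "loc_lin \<phi> r =
     (SOME a. \<exists>f n. r = to_fract f / frac_t ^ n \<and> a = poly_lin \<phi> f * hopf_t (- int n))"

lemma loc_lin_eq:
  assumes "t_equivariant \<phi>"
  shows "loc_lin \<phi> (to_fract f / frac_t ^ n) = poly_lin \<phi> f * hopf_t (- int n)"
proof -
  have "poly_lin \<phi> g * hopf_t (- int m) = poly_lin \<phi> f * hopf_t (- int n)"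
    if "to_fract f / frac_t ^ n = to_fract g / frac_t ^ m" for g m
  proof -
    let ?t = "1 + poly_p * poly_q"
    from that have "to_fract (f * ?t ^ m) = to_fract (g * ?t ^ n)"
      using frac_t_nonzero
      by (simp only: frac_eq_eq power_not_zero not_False_eq_True to_fract_mult to_fract_power)
    then have "f * ?t ^ m = g * ?t ^ n" by (simp only: to_fract_eq_iff)
    then have *: "poly_lin \<phi> f * hopf_t (int m) = poly_lin \<phi> g * hopf_t (int n)"
      using poly_lin_t[OF assms] by metis
    have "poly_lin \<phi> g * hopf_t (- int m)
        = poly_lin \<phi> g * hopf_t (int n) * hopf_t (- int n - int m)"
      by (simp add: mult.assoc flip: hopf_t_add)
    also have "\<dots> = poly_lin \<phi> f * hopf_t (- int n)"
      by (simp add: mult.assoc flip: * hopf_t_add)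
    finally show ?thesis .
  qed
  then show ?thesis
    unfolding loc_lin_def by (intro some_equality) blast+
qed

lemma t_equivariant_left: "t_equivariant \<phi> \<Longrightarrow> t_equivariant (\<lambda>i j. x * \<phi> i j)"
  by (simp add: t_equivariant_def mult.assoc)

lemma t_equivariant_plus:
  "t_equivariant \<phi> \<Longrightarrow> t_equivariant \<psi> \<Longrightarrow> t_equivariant (\<lambda>i j. \<phi> i j + \<psi> i j)"
  by (simp add: t_equivariant_def distrib_right)

lemma t_equivariant_minus:
  "t_equivariant \<phi> \<Longrightarrow> t_equivariant \<psi> \<Longrightarrow> t_equivariant (\<lambda>i j. \<phi> i j - \<psi> i j)"
  by (simp add: t_equivariant_def left_diff_distrib)

lemma t_equivariant_p: "t_equivariant \<phi> \<Longrightarrow> t_equivariant (\<lambda>i j. \<phi> (Suc i) j)"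
  by (simp add: t_equivariant_def)

lemma t_equivariant_q: "t_equivariant \<phi> \<Longrightarrow> t_equivariant (\<lambda>i j. \<phi> i (Suc j))"
  by (simp add: t_equivariant_def)

context
  fixes \<phi> :: "nat \<Rightarrow> nat \<Rightarrow> hopf_alg" and r :: "complex poly poly fract"
  assumes \<phi>: "t_equivariant \<phi>" and r: "r \<in> loc_fractions"
begin

lemma loc_lin_left: "loc_lin (\<lambda>i j. x * \<phi> i j) r = x * loc_lin \<phi> r"
  by (rule loc_fractions_cases[OF r])
    (simp only: loc_lin_eq[OF \<phi>] loc_lin_eq[OF t_equivariant_left[OF \<phi>]] poly_lin_left_index mult.assoc)

lemma loc_lin_plus:
  assumes \<psi>: "t_equivariant \<psi>"
  shows "loc_lin (\<lambda>i j. \<phi> i j + \<psi> i j) r = loc_lin \<phi> r + loc_lin \<psi> r"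
  by (rule loc_fractions_cases[OF r])
    (simp only: loc_lin_eq[OF \<phi>] loc_lin_eq[OF \<psi>]
      loc_lin_eq[OF t_equivariant_plus[OF \<phi> \<psi>]] poly_lin_plus_index distrib_right)

lemma loc_lin_minus:
  assumes \<psi>: "t_equivariant \<psi>"
  shows "loc_lin (\<lambda>i j. \<phi> i j - \<psi> i j) r = loc_lin \<phi> r - loc_lin \<psi> r"
  by (rule loc_fractions_cases[OF r])
    (simp only: loc_lin_eq[OF \<phi>] loc_lin_eq[OF \<psi>]
      loc_lin_eq[OF t_equivariant_minus[OF \<phi> \<psi>]] poly_lin_minus_index left_diff_distrib)

lemma loc_lin_p: "loc_lin \<phi> (frac_p * r) = loc_lin (\<lambda>i j. \<phi> (Suc i) j) r"
proof (rule loc_fractions_cases[OF r])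
  fix f n assume f: "r = to_fract f / frac_t ^ n"
  then have "frac_p * r = to_fract (f * poly_p) / frac_t ^ n" by simp
  then show ?thesis unfolding f by (simp only: loc_lin_eq[OF \<phi>] loc_lin_eq[OF t_equivariant_p[OF \<phi>]] poly_lin_p)
qed

lemma loc_lin_q: "loc_lin \<phi> (frac_q * r) = loc_lin (\<lambda>i j. \<phi> i (Suc j)) r"
proof (rule loc_fractions_cases[OF r])
  fix f n assume f: "r = to_fract f / frac_t ^ n"
  then have "frac_q * r = to_fract (f * poly_q) / frac_t ^ n" by simp
  then show ?thesis unfolding f by (simp only: loc_lin_eq[OF \<phi>] loc_lin_eq[OF t_equivariant_q[OF \<phi>]] poly_lin_q)
qed

lemma loc_lin_scalar: "loc_lin \<phi> (to_fract [:[:c:]:] * r) = hopf_scalar c * loc_lin \<phi> r"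
proof (rule loc_fractions_cases[OF r])
  fix f n assume f: "r = to_fract f / frac_t ^ n"
  then have "to_fract [:[:c:]:] * r = to_fract (f * [:[:c:]:]) / frac_t ^ n"
    by (simp only: to_fract_mult times_divide_eq_right mult.commute)
  then show ?thesis unfolding f by (simp only: loc_lin_eq[OF \<phi>] poly_lin_scalar mult.assoc)
qed

lemma loc_lin_add:
  assumes "r' \<in> loc_fractions"
  shows "loc_lin \<phi> (r + r') = loc_lin \<phi> r + loc_lin \<phi> r'"
proof (rule loc_fractions_cases[OF r], rule loc_fractions_cases[OF assms])
  fix f n f' n' assume f: "r = to_fract f / frac_t ^ n" "r' = to_fract f' / frac_t ^ n'"
  have "r + r' = to_fract (f * (1 + poly_p * poly_q) ^ n' + f' * (1 + poly_p * poly_q) ^ n)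
      / frac_t ^ (n + n')"
    using frac_t_nonzero unfolding f by (simp only: to_fract_add to_fract_mult to_fract_power
      add_frac_eq power_not_zero not_False_eq_True power_add)
  then show ?thesis
    unfolding f
    by (simp only: loc_lin_eq[OF \<phi>] poly_lin_add poly_lin_t[OF \<phi>] distrib_right mult.assoc)
      (simp flip: hopf_t_add)
qed

end

text \<open>
  The right factor is a cycle, so the Leibniz rule has no sign and holds for a left factor that is
  not homogeneous.
\<close>

lemma explicit_d_mult_cycle:
  assumes "explicit_d y = 0"
  shows "explicit_d (x * y) = explicit_d x * y"
proof (induction x rule: hopf_alg_induct)
  case zero
  then show ?case by (simp add: explicit_d_0)
next
  case (add c w x)
  have "explicit_d (hopf_scalar c * hopf_mon w * y) = hopf_scalar c * word_d w * y"
    by (simp add: mult.assoc explicit_d_scalar explicit_d_mon_mult assms)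
  with add show ?case by (simp add: distrib_right explicit_d_add explicit_d_single)
qed

lemma explicit_d_t: "explicit_d (hopf_t m) = 0"
  by (simp add: hopf_t_def explicit_d_mon)

lemma explicit_d_loc_lin:
  assumes \<phi>: "t_equivariant \<phi>" and r: "r \<in> loc_fractions"
  shows "explicit_d (loc_lin \<phi> r) = loc_lin (\<lambda>i j. explicit_d (\<phi> i j)) r"
proof -
  have "explicit_d (hopf_t 1 - 1) = 0"
    using explicit_d_add[of "hopf_t 1 - 1" 1] explicit_d_t[of 0] explicit_d_t[of 1]
    by (simp add: hopf_t_0)
  then have d\<phi>: "t_equivariant (\<lambda>i j. explicit_d (\<phi> i j))"
    using \<phi> by (simp add: t_equivariant_def explicit_d_mult_cycle)
  show ?thesis
    by (rule loc_fractions_cases[OF r])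
      (simp only: loc_lin_eq[OF \<phi>] loc_lin_eq[OF d\<phi>] explicit_d_mult_cycle explicit_d_t explicit_d_poly_lin)
qed


section \<open>The contracting homotopy\<close>

abbreviation "hopf_p \<equiv> hopf_gen P"
abbreviation "hopf_q \<equiv> hopf_gen Q"
abbreviation "hopf_a1 \<equiv> hopf_gen A1"
abbreviation "hopf_a2 \<equiv> hopf_gen A2"

lemma explicit_d_gen: "explicit_d (hopf_gen g) = gen_d g"
  by (simp add: hopf_gen_def explicit_d_mon hopf_t_0 hopf_mon_Tpow)

lemma explicit_d_gen_mult:
  "explicit_d (hopf_gen g * x)
     = gen_d g * x + koszul_sign (int (gen_degree g)) * hopf_gen g * explicit_d x"
  by (simp add: explicit_d_leibniz[OF degree_part_gen] explicit_d_gen)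

lemma explicit_d_p: "explicit_d (hopf_p * x) = hopf_p * explicit_d x"
  and explicit_d_q: "explicit_d (hopf_q * x) = hopf_q * explicit_d x"
  and explicit_d_a1: "explicit_d (hopf_a1 * x) = gen_d A1 * x - hopf_a1 * explicit_d x"
  and explicit_d_a2: "explicit_d (hopf_a2 * x) = gen_d A2 * x - hopf_a2 * explicit_d x"
  by (simp_all add: explicit_d_gen_mult koszul_sign_def)

lemma explicit_d_t_mult: "explicit_d (hopf_t m * x) = hopf_t m * explicit_d x"
  by (simp add: explicit_d_leibniz[OF degree_part_t] explicit_d_t koszul_sign_def)

lemma explicit_d_uminus: "explicit_d (- x) = - explicit_d x"
  using explicit_d_add[of x "- x"] by (simp add: explicit_d_0 eq_neg_iff_add_eq_0 add.commute)

lemma explicit_d_minus: "explicit_d (x - y) = explicit_d x - explicit_d y"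
  using explicit_d_add[of x "- y"] by (simp add: explicit_d_uminus)

lemma explicit_d_1: "explicit_d 1 = 0"
  using explicit_d_t[of 0] by (simp add: hopf_t_0)

lemma explicit_d_gen_power:
  assumes "gen_degree g = 0"
  shows "explicit_d (hopf_gen g ^ n) = 0"
proof (induction n)
  case (Suc n)
  have "gen_d g = 0" using assms by (cases g) simp_all
  with Suc show ?case by (simp add: explicit_d_gen_mult)
qed (simp add: explicit_d_1)

lemma explicit_d_t_minus_one_power: "explicit_d ((hopf_t 1 - 1) ^ n) = 0"
proof (induction n)
  case (Suc n)
  then show ?case
    by (simp add: left_diff_distrib explicit_d_minus explicit_d_t_mult)
qed (simp add: explicit_d_1)

text \<open>
  The value of the section at \<open>p\<^sup>i q\<^sup>j\<close>, which in the localization equals \<open>p\<^sup>i\<^sup>-\<^sup>j (t - 1)\<^sup>j\<close> or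
  \<open>q\<^sup>j\<^sup>-\<^sup>i (t - 1)\<^sup>i\<close>. With truncated subtraction one of the first two factors is always \<open>1\<close>.
\<close>

definition section_index :: "nat \<Rightarrow> nat \<Rightarrow> hopf_alg" where
  "section_index i j = hopf_p ^ (i - j) * hopf_q ^ (j - i) * (hopf_t 1 - 1) ^ min i j"

text \<open>
  \<open>p_chain n\<close> bounds the difference of \<open>p q\<^sup>n\<close> and its normal form \<open>q\<^sup>n\<^sup>-\<^sup>1 (t - 1)\<close>. For \<open>n = 1\<close> this is
  the definition of \<open>d a2\<close>. For larger \<open>n\<close>, the letter \<open>p\<close> is first moved past a letter \<open>q\<close>, which
  costs \<open>a2 - a1\<close>, since \<open>d(a2 - a1) = pq - qp\<close>.
\<close>

fun p_chain :: "nat \<Rightarrow> hopf_alg" where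
  "p_chain 0 = 0"
| "p_chain (Suc 0) = hopf_a2"
| "p_chain (Suc (Suc n)) = hopf_q * p_chain (Suc n) + (hopf_a2 - hopf_a1) * hopf_q ^ Suc n"

fun q_chain :: "nat \<Rightarrow> hopf_alg" where
  "q_chain 0 = 0"
| "q_chain (Suc 0) = hopf_a1"
| "q_chain (Suc (Suc n)) = hopf_p * q_chain (Suc n) - (hopf_a2 - hopf_a1) * hopf_p ^ Suc n"

text \<open>
  The correction \<open>H_p\<close> for multiplication by \<open>p\<close>. It vanishes on \<open>p\<^sup>i t\<^sup>m\<close>, because \<open>p\<close> times the word
  \<open>p\<^sup>i t\<^sup>m\<close> is again a word in normal form. The roles of \<open>p\<close> and \<open>q\<close> are exchanged in \<open>q_index\<close>.
\<close>

definition p_index :: "nat \<Rightarrow> nat \<Rightarrow> hopf_alg" where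
  "p_index i j = p_chain (j - i) * (hopf_t 1 - 1) ^ min i j"

definition q_index :: "nat \<Rightarrow> nat \<Rightarrow> hopf_alg" where
  "q_index i j = q_chain (i - j) * (hopf_t 1 - 1) ^ min i j"

lemma t_equivariant_index:
  "t_equivariant section_index" "t_equivariant p_index" "t_equivariant q_index"
  by (simp_all add: t_equivariant_def section_index_def p_index_def q_index_def
      mult.assoc power_commutes)

lemma explicit_d_p_chain:
  "explicit_d (p_chain (Suc n)) = hopf_p * hopf_q ^ Suc n - hopf_q ^ n * (hopf_t 1 - 1)"
proof (induction n)
  case 0
  then show ?case by (simp add: explicit_d_gen)
next
  case (Suc n)
  have q: "hopf_q ^ n * hopf_q = hopf_q * hopf_q ^ n" by (rule power_commutes)
  show ?case
    using Suc explicit_d_gen_power[of Q n]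
    by (simp add: explicit_d_add explicit_d_minus explicit_d_q explicit_d_a1 explicit_d_a2
        left_diff_distrib)
      (simp add: algebra_simps q)
qed

lemma explicit_d_q_chain:
  "explicit_d (q_chain (Suc n)) = hopf_q * hopf_p ^ Suc n - hopf_p ^ n * (hopf_t 1 - 1)"
proof (induction n)
  case 0
  then show ?case by (simp add: explicit_d_gen)
next
  case (Suc n)
  have p: "hopf_p ^ n * hopf_p = hopf_p * hopf_p ^ n" by (rule power_commutes)
  show ?case
    using Suc explicit_d_gen_power[of P n]
    by (simp add: explicit_d_add explicit_d_minus explicit_d_p explicit_d_a1 explicit_d_a2
        left_diff_distrib)
      (simp add: algebra_simps p)
qed

lemma explicit_d_p_index:
  "explicit_d (p_index i j) = hopf_p * section_index i j - section_index (Suc i) j"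
proof (cases "j \<le> i")
  case True
  then show ?thesis
    by (simp add: p_index_def section_index_def explicit_d_0 Suc_diff_le mult.assoc min_def)
next
  case False
  then obtain k where "j = Suc (i + k)" using less_iff_Suc_add[of i j] by auto
  then show ?thesis
    by (simp add: p_index_def section_index_def explicit_d_mult_cycle
        explicit_d_t_minus_one_power explicit_d_p_chain min_def Suc_diff_le del: power_Suc)
      (simp add: algebra_simps)
qed

lemma explicit_d_q_index:
  "explicit_d (q_index i j) = hopf_q * section_index i j - section_index i (Suc j)"
proof (cases "i \<le> j")
  case True
  then show ?thesis
    by (simp add: q_index_def section_index_def explicit_d_0 Suc_diff_le mult.assoc min_def)
next
  case False
  then obtain k where "i = Suc (j + k)" using less_iff_Suc_add[of j i] by auto
  then show ?thesis
    by (simp add: q_index_def section_index_def explicit_d_mult_cycle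
        explicit_d_t_minus_one_power explicit_d_q_chain min_def Suc_diff_le del: power_Suc)
      (simp add: algebra_simps)
qed

text \<open>
  The compatibility that makes the two formulas for \<open>H_t\<close> agree. Away from the diagonal \<open>i = j\<close> it is
  the recursion of one of the chains; on the diagonal it is the difference of their initial values.
\<close>

lemma index_exchange:
  "hopf_p * q_index i j + p_index i (Suc j) - hopf_q * p_index i j - q_index (Suc i) j
     = (hopf_a2 - hopf_a1) * section_index i j"
proof -
  consider "i = j" | k where "j = Suc (i + k)" | k where "i = Suc (j + k)"
    using less_iff_Suc_add[of i j] less_iff_Suc_add[of j i] by (metis linorder_neqE_nat)
  then show ?thesis
  proof cases
    case 1
    then show ?thesis
      by (simp add: p_index_def q_index_def section_index_def left_diff_distrib min_def)
  next
    case 2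
    then show ?thesis
      by (simp add: p_index_def q_index_def section_index_def min_def Suc_diff_le del: power_Suc)
        (simp add: algebra_simps)
  next
    case 3
    then show ?thesis
      by (simp add: p_index_def q_index_def section_index_def min_def Suc_diff_le del: power_Suc)
        (simp add: algebra_simps)
  qed
qed

abbreviation "loc_section \<equiv> loc_lin section_index"
abbreviation "homotopy_p \<equiv> loc_lin p_index"
abbreviation "homotopy_q \<equiv> loc_lin q_index"

lemma explicit_d_homotopy_p:
  assumes r: "r \<in> loc_fractions"
  shows "explicit_d (homotopy_p r) = hopf_p * loc_section r - loc_section (frac_p * r)"
proof -
  note s = t_equivariant_index(1)
  have "explicit_d (homotopy_p r) = loc_lin (\<lambda>i j. hopf_p * section_index i j - section_index (Suc i) j) r"
    by (simp add: explicit_d_loc_lin[OF t_equivariant_index(2) r] explicit_d_p_index)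
  then show ?thesis
    by (simp add: loc_lin_minus[OF t_equivariant_left[OF s] r t_equivariant_p[OF s]]
        loc_lin_left[OF s r] loc_lin_p[OF s r])
qed

lemma explicit_d_homotopy_q:
  assumes r: "r \<in> loc_fractions"
  shows "explicit_d (homotopy_q r) = hopf_q * loc_section r - loc_section (frac_q * r)"
proof -
  note s = t_equivariant_index(1)
  have "explicit_d (homotopy_q r) = loc_lin (\<lambda>i j. hopf_q * section_index i j - section_index i (Suc j)) r"
    by (simp add: explicit_d_loc_lin[OF t_equivariant_index(3) r] explicit_d_q_index)
  then show ?thesis
    by (simp add: loc_lin_minus[OF t_equivariant_left[OF s] r t_equivariant_q[OF s]]
        loc_lin_left[OF s r] loc_lin_q[OF s r])
qed

lemma homotopy_exchange:
  assumes r: "r \<in> loc_fractions"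
  shows "hopf_p * homotopy_q r + homotopy_p (frac_q * r)
           - hopf_q * homotopy_p r - homotopy_q (frac_p * r)
         = (hopf_a2 - hopf_a1) * loc_section r"
proof -
  note s = t_equivariant_index(1) and p = t_equivariant_index(2) and q = t_equivariant_index(3)
  note 1 = t_equivariant_plus[OF t_equivariant_left[OF q] t_equivariant_q[OF p]]
  note 2 = t_equivariant_minus[OF 1 t_equivariant_left[OF p]]
  have "loc_lin (\<lambda>i j. hopf_p * q_index i j + p_index i (Suc j) - hopf_q * p_index i j - q_index (Suc i) j) r
      = hopf_p * homotopy_q r + homotopy_p (frac_q * r)
           - hopf_q * homotopy_p r - homotopy_q (frac_p * r)"
    by (simp add: loc_lin_minus[OF 2 r t_equivariant_p[OF q]]
        loc_lin_minus[OF 1 r t_equivariant_left[OF p]]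
        loc_lin_plus[OF t_equivariant_left[OF q] r t_equivariant_q[OF p]]
        loc_lin_left[OF q r] loc_lin_left[OF p r] loc_lin_p[OF q r] loc_lin_q[OF p r])
  then show ?thesis by (simp add: index_exchange loc_lin_left[OF s r])
qed

text \<open>
  The correction \<open>H_t\<close> for left multiplication by \<open>t\<close>, obtained by solving
  \<open>h(d(a1) x) = d(a1) h(x) + a1 \<sigma>(ev(x))\<close> for it. Solving the same equation for \<open>a2\<close> gives the
  formula in \<open>homotopy_t1_alt\<close>.
\<close>

definition homotopy_t1 :: "complex poly poly fract \<Rightarrow> hopf_alg" where
  "homotopy_t1 r = hopf_q * homotopy_p r + homotopy_q (frac_p * r) - hopf_a1 * loc_section r"

lemma homotopy_t1_alt:
  "r \<in> loc_fractions \<Longrightarrow>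
   homotopy_t1 r = hopf_p * homotopy_q r + homotopy_p (frac_q * r) - hopf_a2 * loc_section r"
  using homotopy_exchange[of r] by (simp add: homotopy_t1_def algebra_simps)

lemma explicit_d_loc_section:
  assumes "r \<in> loc_fractions"
  shows "explicit_d (loc_section r) = 0"
proof -
  have "explicit_d (section_index i j) = 0" for i j
    by (simp add: section_index_def explicit_d_mult_cycle explicit_d_t_minus_one_power
        explicit_d_gen_power)
  moreover have "loc_lin (\<lambda>i j. 0) r = 0"
    using loc_lin_left[OF t_equivariant_index(1) assms, of 0] by simp
  ultimately show ?thesis
    by (simp add: explicit_d_loc_lin[OF t_equivariant_index(1) assms])
qed

lemma loc_fractions_p_q: "frac_p \<in> loc_fractions" "frac_q \<in> loc_fractions"
  by (rule loc_fractions_to_fract)+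

lemma loc_section_t:
  assumes r: "r \<in> loc_fractions"
  shows "loc_section (frac_t * r) = loc_section r + loc_section (frac_q * (frac_p * r))"
proof -
  note s = t_equivariant_index(1)
  have "frac_t * r = r + frac_q * (frac_p * r)" by (simp add: algebra_simps)
  moreover have "frac_q * (frac_p * r) \<in> loc_fractions"
    by (intro loc_fractions_closed loc_fractions_p_q r)
  ultimately show ?thesis by (metis loc_lin_add[OF s r])
qed

lemma explicit_d_homotopy_t1:
  assumes r: "r \<in> loc_fractions"
  shows "explicit_d (homotopy_t1 r) = hopf_t 1 * loc_section r - loc_section (frac_t * r)"
proof -
  have pr: "frac_p * r \<in> loc_fractions" by (intro loc_fractions_closed loc_fractions_p_q r)
  show ?thesis
    unfolding homotopy_t1_def
    by (simp only: explicit_d_minus explicit_d_add explicit_d_q explicit_d_a1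
        explicit_d_homotopy_p[OF r] explicit_d_homotopy_q[OF pr] explicit_d_loc_section[OF r]
        loc_section_t[OF r])
      (simp add: algebra_simps)
qed

text \<open>
  The correction for \<open>t\<^sup>m\<close> is determined by the one for \<open>t\<close> through the twisted Leibniz rule
  \<open>homotopy_t_cocycle\<close>. At most one of the two sums is nonempty; the second one covers negative \<open>m\<close>.
\<close>

definition homotopy_t :: "int \<Rightarrow> complex poly poly fract \<Rightarrow> hopf_alg" where
  "homotopy_t m r =
     (\<Sum>k\<in>{0..<m}. hopf_t (m - 1 - k) * homotopy_t1 (frac_t powi k * r))
     - (\<Sum>k\<in>{m..<0}. hopf_t (m - 1 - k) * homotopy_t1 (frac_t powi k * r))"

lemma homotopy_t_0: "homotopy_t 0 r = 0"
  by (simp add: homotopy_t_def)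

lemma homotopy_t_step:
  "homotopy_t (m + 1) r = hopf_t 1 * homotopy_t m r + homotopy_t1 (frac_t powi m * r)"
proof -
  let ?g = "\<lambda>m k. hopf_t (m - 1 - k) * homotopy_t1 (frac_t powi k * r)"
  have g: "hopf_t 1 * ?g m k = ?g (m + 1) k" for k
  proof -
    have "hopf_t 1 * hopf_t (m - 1 - k) = hopf_t (m + 1 - 1 - k)"
      unfolding hopf_t_add[symmetric] by (rule arg_cong[where f = hopf_t]) simp
    then show ?thesis by (simp only: mult.assoc[symmetric])
  qed
  show ?thesis
  proof (cases "0 \<le> m")
    case True
    then have "{0..<m + 1} = insert m {0..<m}" "{m + 1..<0} = {}" "{m..<0} = {}" by auto
    then show ?thesis
      by (simp only: homotopy_t_def right_diff_distrib sum_distrib_left g)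
        (simp add: hopf_t_0)
  next
    case False
    then have "{m..<0} = insert m {m + 1..<0}" "{0..<m + 1} = {}" "{0..<m} = {}" by auto
    then show ?thesis
      by (simp only: homotopy_t_def right_diff_distrib sum_distrib_left g)
        (simp add: hopf_t_0)
  qed
qed

lemma hopf_t_cancel:
  assumes "hopf_t m * x = hopf_t m * y"
  shows "x = y"
proof -
  have "hopf_t (- m) * (hopf_t m * x) = hopf_t (- m) * (hopf_t m * y)" using assms by simp
  then show ?thesis by (simp add: hopf_t_0 flip: mult.assoc hopf_t_add)
qed

lemma frac_t_powi_step: "frac_t powi (m + 1) = frac_t * frac_t powi m"
  using frac_t_nonzero by (simp only: power_int_add_1' simp_thms)

text \<open>
  The step equation can be solved in both directions because \<open>t\<close> is invertible in \<open>A\<close>.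
\<close>

lemma homotopy_t_unique:
  assumes "T 0 = (0 :: hopf_alg)"
    and "\<And>m. T (m + 1) = hopf_t 1 * T m + homotopy_t1 (frac_t powi m * r)"
  shows "T m = homotopy_t m r"
proof (induction m rule: int_induct[where k = 0])
  case base
  then show ?case by (simp add: assms(1) homotopy_t_0)
next
  case (step1 i)
  then show ?case by (simp add: assms(2) homotopy_t_step)
next
  case (step2 i)
  then have "hopf_t 1 * T (i - 1) = hopf_t 1 * homotopy_t (i - 1) r"
    using assms(2)[of "i - 1"] homotopy_t_step[of "i - 1" r] by simp
  then show ?case by (rule hopf_t_cancel)
qed

lemma homotopy_t_cocycle:
  "homotopy_t (m + n) r = hopf_t m * homotopy_t n r + homotopy_t m (frac_t powi n * r)"
proof -
  \<comment> \<open>Both sides, as functions of \<open>m\<close>, satisfy the step equation at \<open>t\<^sup>n r\<close>.\<close>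
  let ?T = "\<lambda>m. homotopy_t (m + n) r - hopf_t m * homotopy_t n r"
  have "?T m = homotopy_t m (frac_t powi n * r)"
  proof (rule homotopy_t_unique)
    fix m
    have 1: "homotopy_t (m + 1 + n) r
        = hopf_t 1 * homotopy_t (m + n) r + homotopy_t1 (frac_t powi (m + n) * r)"
      using homotopy_t_step[of "m + n" r] by (simp add: add_ac)
    have 2: "frac_t powi (m + n) * r = frac_t powi m * (frac_t powi n * r)"
      using frac_t_nonzero by (simp only: power_int_add simp_thms mult.assoc)
    have 3: "hopf_t (m + 1) = hopf_t 1 * hopf_t m"
      by (simp add: add.commute flip: hopf_t_add)
    show "?T (m + 1) = hopf_t 1 * ?T m + homotopy_t1 (frac_t powi m * (frac_t powi n * r))"
      by (simp only: 1 2 3) (simp add: algebra_simps)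
  qed (simp add: hopf_t_0)
  then show ?thesis by (simp add: algebra_simps)
qed

lemma explicit_d_homotopy_t:
  assumes r: "r \<in> loc_fractions"
  shows "explicit_d (homotopy_t m r) = hopf_t m * loc_section r - loc_section (frac_t powi m * r)"
proof -
  have step: "explicit_d (homotopy_t (m + 1) r) = hopf_t 1 * explicit_d (homotopy_t m r)
      + hopf_t 1 * loc_section (frac_t powi m * r) - loc_section (frac_t powi (m + 1) * r)" for m
    using explicit_d_homotopy_t1[of "frac_t powi m * r"] loc_fractions_mult[OF loc_fractions_t r, of m]
    by (simp only: homotopy_t_step explicit_d_add explicit_d_t_mult frac_t_powi_step mult.assoc)
      (simp add: algebra_simps)
  have t1: "hopf_t (m + 1) = hopf_t 1 * hopf_t m" for m
    by (simp add: add.commute flip: hopf_t_add)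
  show ?thesis
  proof (induction m rule: int_induct[where k = 0])
    case base
    then show ?case by (simp add: homotopy_t_0 explicit_d_0 hopf_t_0)
  next
    case (step1 i)
    show ?case unfolding step t1 step1 by (simp add: algebra_simps)
  next
    case (step2 i)
    \<comment> \<open>The step from \<open>i - 1\<close> to \<open>i\<close> is read backwards, cancelling \<open>t\<close> on the left.\<close>
    have "hopf_t 1 * explicit_d (homotopy_t (i - 1) r)
      = hopf_t 1 * (hopf_t (i - 1) * loc_section r - loc_section (frac_t powi (i - 1) * r))"
      using step2 step[of "i - 1"] t1[of "i - 1"] by (simp add: algebra_simps)
    then show ?case by (rule hopf_t_cancel)
  qed
qed


section \<open>The evaluation in the localization\<close>

abbreviation frac_const :: "complex \<Rightarrow> complex poly poly fract" where
  "frac_const c \<equiv> to_fract [:[:c:]:]"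

lemma frac_const_0: "frac_const 0 = 0"
  and frac_const_1: "frac_const 1 = 1"
  and frac_const_add: "frac_const (a + b) = frac_const a + frac_const b"
  and frac_const_mult: "frac_const (a * b) = frac_const a * frac_const b"
  by (simp_all flip: one_pCons to_fract_add to_fract_mult)

fun gen_ev :: "hopf_gen \<Rightarrow> complex poly poly fract" where
  "gen_ev A1 = 0"
| "gen_ev A2 = 0"
| "gen_ev P = frac_p"
| "gen_ev Q = frac_q"

fun word_ev :: "hopf_word \<Rightarrow> complex poly poly fract" where
  "word_ev (Tpow m) = frac_t powi m"
| "word_ev (Gen m g w) = frac_t powi m * (gen_ev g * word_ev w)"

definition hopf_ev :: "hopf_alg \<Rightarrow> complex poly poly fract" where
  "hopf_ev = word_lin frac_const word_ev"

lemma frac_t_powi_add: "frac_t powi (m + n) = frac_t powi m * frac_t powi n"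
  using frac_t_nonzero by (simp only: power_int_add simp_thms)

lemma word_ev_add: "word_ev (v + w) = word_ev v * word_ev w"
proof (induction v)
  case (Tpow m)
  show ?case by (cases w) (simp_all only: plus_hopf_word.simps word_ev.simps frac_t_powi_add mult.assoc)
next
  case (Gen m g v)
  then show ?case by (simp only: plus_hopf_word.simps word_ev.simps mult.assoc)
qed

lemma hopf_ev_add: "hopf_ev (x + y) = hopf_ev x + hopf_ev y"
  unfolding hopf_ev_def by (rule word_lin_add) (simp_all only: frac_const_0 frac_const_add)

lemma hopf_ev_single: "hopf_ev (hopf_scalar c * hopf_mon w) = frac_const c * word_ev w"
  unfolding hopf_ev_def by (rule word_lin_single) (rule frac_const_0)

lemma hopf_ev_mon: "hopf_ev (hopf_mon w) = word_ev w"
  unfolding hopf_ev_def by (rule word_lin_mon) (rule frac_const_0, rule frac_const_1)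

lemma hopf_ev_0: "hopf_ev 0 = 0"
  by (simp add: hopf_ev_def word_lin_0)

lemma hopf_ev_uminus: "hopf_ev (- x) = - hopf_ev x"
  using hopf_ev_add[of x "- x"] by (simp add: hopf_ev_0 eq_neg_iff_add_eq_0 add.commute)

lemma hopf_ev_minus: "hopf_ev (x - y) = hopf_ev x - hopf_ev y"
  using hopf_ev_add[of x "- y"] by (simp add: hopf_ev_uminus)

lemma hopf_ev_scalar: "hopf_ev (hopf_scalar c * x) = frac_const c * hopf_ev x"
proof (induction x rule: hopf_alg_induct)
  case zero
  then show ?case by (simp add: hopf_ev_0)
next
  case (add e w x)
  have "hopf_scalar c * (hopf_scalar e * hopf_mon w) = hopf_scalar (c * e) * hopf_mon w"
    by (simp only: hopf_scalar_mult mult.assoc)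
  then show ?case
    by (simp only: add hopf_ev_add hopf_ev_single distrib_left frac_const_mult mult.assoc)
qed

lemma hopf_ev_mon_mult: "hopf_ev (hopf_mon v * x) = word_ev v * hopf_ev x"
proof (induction x rule: hopf_alg_induct)
  case zero
  then show ?case by (simp add: hopf_ev_0)
next
  case (add e w x)
  have "hopf_mon v * (hopf_scalar e * hopf_mon w) = hopf_scalar e * hopf_mon (v + w)"
    by (metis hopf_scalar_commute mult.assoc hopf_mon_add)
  then show ?case
    by (simp only: add hopf_ev_add hopf_ev_single distrib_left word_ev_add mult_ac)
qed

lemma hopf_ev_mult: "hopf_ev (x * y) = hopf_ev x * hopf_ev y"
proof (induction x rule: hopf_alg_induct)
  case zero
  then show ?case by (simp add: hopf_ev_0)
next
  case (add c w x)
  then show ?case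
    by (simp only: hopf_ev_add hopf_ev_single distrib_right mult.assoc hopf_ev_scalar hopf_ev_mon_mult
        hopf_ev_mon)
qed

lemma hopf_ev_gen: "hopf_ev (hopf_gen g) = gen_ev g"
  by (simp add: hopf_gen_def hopf_ev_mon del: to_fract_add to_fract_mult)

lemma hopf_ev_t: "hopf_ev (hopf_t m) = frac_t powi m"
  by (simp add: hopf_t_def hopf_ev_mon del: to_fract_add to_fract_mult)

lemma hopf_ev_1: "hopf_ev 1 = 1"
  using hopf_ev_t[of 0] by (simp add: hopf_t_0)

lemma hopf_ev_hopf_scalar: "hopf_ev (hopf_scalar c) = frac_const c"
  using hopf_ev_scalar[of c 1] by (simp add: hopf_ev_1)

text \<open>
  This matters because maps given by \<open>loc_lin\<close> are meaningful only on the localization.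
\<close>

lemma hopf_ev_in_loc_fractions: "hopf_ev x \<in> loc_fractions"
proof (induction x rule: hopf_alg_induct)
  case zero
  then show ?case by (simp add: hopf_ev_0 loc_fractions_0)
next
  case (add c w x)
  have gen: "gen_ev g \<in> loc_fractions" for g
    by (cases g) (simp_all only: gen_ev.simps loc_fractions_closed)
  have "word_ev w \<in> loc_fractions"
    by (induction w) (simp_all only: word_ev.simps loc_fractions_closed gen)
  with add show ?case by (simp only: hopf_ev_add hopf_ev_single loc_fractions_closed)
qed

lemma hopf_ev_gen_d: "hopf_ev (gen_d g) = 0"
  by (cases g) (simp_all add: hopf_ev_add hopf_ev_minus hopf_ev_mult hopf_ev_gen hopf_ev_t hopf_ev_1
      hopf_ev_0)

lemma hopf_ev_word_d: "hopf_ev (word_d w) = 0"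
  by (induction w) (simp_all add: hopf_ev_0 hopf_ev_add hopf_ev_mult hopf_ev_gen_d)

lemma hopf_ev_explicit_d: "hopf_ev (explicit_d x) = 0"
  by (induction x rule: hopf_alg_induct)
    (simp_all add: explicit_d_0 hopf_ev_0 explicit_d_add hopf_ev_add explicit_d_single hopf_ev_scalar
      hopf_ev_word_d)

section \<open>The homotopy on words\<close>

text \<open>
  Linearity is required on the localization only, because \<open>loc_lin\<close> has unspecified values elsewhere
  in the field of fractions. This suffices to pass from words to their linear combinations.
\<close>

definition loc_linear :: "(complex poly poly fract \<Rightarrow> hopf_alg) \<Rightarrow> bool" where
  "loc_linear T \<longleftrightarrow>
     (\<forall>r\<in>loc_fractions. \<forall>r'\<in>loc_fractions. T (r + r') = T r + T r') \<and>
     (\<forall>c. \<forall>r\<in>loc_fractions. T (frac_const c * r) = hopf_scalar c * T r)"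

lemma loc_linear_loc_lin: "t_equivariant \<phi> \<Longrightarrow> loc_linear (loc_lin \<phi>)"
  unfolding loc_linear_def using loc_lin_add loc_lin_scalar by blast

lemma scalar_left_commute: "x * (hopf_scalar c * y) = hopf_scalar c * (x * y)"
  by (metis hopf_scalar_commute mult.assoc)

lemma loc_linear_left: "loc_linear T \<Longrightarrow> loc_linear (\<lambda>r. x * T r)"
  by (simp add: loc_linear_def distrib_left scalar_left_commute)

lemma loc_linear_add: "loc_linear T \<Longrightarrow> loc_linear T' \<Longrightarrow> loc_linear (\<lambda>r. T r + T' r)"
  by (simp add: loc_linear_def distrib_left)

lemma loc_linear_minus: "loc_linear T \<Longrightarrow> loc_linear T' \<Longrightarrow> loc_linear (\<lambda>r. T r - T' r)"
  by (simp add: loc_linear_def right_diff_distrib)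

lemma loc_linear_sum: "(\<And>k. k \<in> K \<Longrightarrow> loc_linear (T k)) \<Longrightarrow> loc_linear (\<lambda>r. \<Sum>k\<in>K. T k r)"
  by (simp add: loc_linear_def sum.distrib sum_distrib_left)

lemma loc_linear_shift: "loc_linear T \<Longrightarrow> u \<in> loc_fractions \<Longrightarrow> loc_linear (\<lambda>r. T (u * r))"
  by (simp add: loc_linear_def distrib_left loc_fractions_mult mult.left_commute[of u])

lemma loc_linear_zero: "loc_linear (\<lambda>r. 0)"
  by (simp add: loc_linear_def)

lemma loc_linear_homotopy_t1: "loc_linear homotopy_t1"
  unfolding homotopy_t1_def
  by (intro loc_linear_add loc_linear_minus loc_linear_left loc_linear_shift[of "homotopy_q"]
      loc_linear_loc_lin t_equivariant_index loc_fractions_p_q)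

lemma loc_linear_homotopy_t: "loc_linear (homotopy_t m)"
  unfolding homotopy_t_def
  by (intro loc_linear_minus loc_linear_sum loc_linear_left loc_linear_shift[of "homotopy_t1"]
      loc_linear_homotopy_t1 loc_fractions_t)

fun gen_homotopy :: "hopf_gen \<Rightarrow> complex poly poly fract \<Rightarrow> hopf_alg" where
  "gen_homotopy P r = homotopy_p r"
| "gen_homotopy Q r = homotopy_q r"
| "gen_homotopy A1 r = 0"
| "gen_homotopy A2 r = 0"

lemma loc_linear_gen_homotopy: "loc_linear (gen_homotopy g)"
proof -
  have "gen_homotopy P = homotopy_p" "gen_homotopy Q = homotopy_q"
    "gen_homotopy A1 = (\<lambda>r. 0)" "gen_homotopy A2 = (\<lambda>r. 0)" by auto
  then show ?thesis
    using loc_linear_loc_lin t_equivariant_index loc_linear_zero by (cases g) metis+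
qed

text \<open>
  The twisted derivation rule for the letters \<open>t\<^sup>m\<close> and \<open>g\<close> of a word, read from the left. The powers
  \<open>t\<^sup>m\<close> themselves are in normal form and need no correction.
\<close>

fun word_homotopy :: "hopf_word \<Rightarrow> hopf_alg" where
  "word_homotopy (Tpow m) = 0"
| "word_homotopy (Gen m g w) =
     hopf_t m * (koszul_sign (int (gen_degree g)) * (hopf_gen g * word_homotopy w)
       + gen_homotopy g (word_ev w))
     + homotopy_t m (gen_ev g * word_ev w)"

definition homotopy :: "hopf_alg \<Rightarrow> hopf_alg" where
  "homotopy = word_lin hopf_scalar word_homotopy"

lemma homotopy_add: "homotopy (x + y) = homotopy x + homotopy y"
  unfolding homotopy_def by (rule word_lin_add) (simp_all only: hopf_scalar_0 hopf_scalar_add)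

lemma homotopy_single: "homotopy (hopf_scalar c * hopf_mon w) = hopf_scalar c * word_homotopy w"
  unfolding homotopy_def by (rule word_lin_single) (rule hopf_scalar_0)

lemma homotopy_mon: "homotopy (hopf_mon w) = word_homotopy w"
  unfolding homotopy_def by (rule word_lin_mon) (rule hopf_scalar_0, rule hopf_scalar_1)

lemma homotopy_0: "homotopy 0 = 0"
  by (simp add: homotopy_def word_lin_0)

lemma homotopy_uminus: "homotopy (- x) = - homotopy x"
  using homotopy_add[of x "- x"] by (simp add: homotopy_0 eq_neg_iff_add_eq_0 add.commute)

lemma homotopy_minus: "homotopy (x - y) = homotopy x - homotopy y"
  using homotopy_add[of x "- y"] by (simp add: homotopy_uminus)

lemma homotopy_scalar: "homotopy (hopf_scalar c * x) = hopf_scalar c * homotopy x"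
proof (induction x rule: hopf_alg_induct)
  case zero
  then show ?case by (simp add: homotopy_0)
next
  case (add e w x)
  have "homotopy (hopf_scalar c * (hopf_scalar e * hopf_mon w))
      = hopf_scalar c * (hopf_scalar e * word_homotopy w)"
    using homotopy_single[of "c * e" w] by (simp only: hopf_scalar_mult mult.assoc)
  with add show ?case
    by (simp only: homotopy_add homotopy_single distrib_left)
qed

text \<open>
  Reduces a twisted derivation rule for left multiplication by a fixed element to words.
\<close>

lemma homotopy_mult_extend:
  assumes H: "loc_linear H"
    and mon: "\<And>w. homotopy (y * hopf_mon w) = z * word_homotopy w + H (word_ev w)"
  shows "homotopy (y * x) = z * homotopy x + H (hopf_ev x)"
proof (induction x rule: hopf_alg_induct)
  case zero
  have "H (frac_const 0 * 0) = hopf_scalar 0 * H 0"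
    using H loc_fractions_0 unfolding loc_linear_def by blast
  then show ?case by (simp add: homotopy_0 hopf_ev_0 hopf_scalar_0)
next
  case (add c w x)
  have w: "word_ev w \<in> loc_fractions"
    using hopf_ev_in_loc_fractions[of "hopf_mon w"] by (simp only: hopf_ev_mon)
  have H1: "H (frac_const c * word_ev w + hopf_ev x) = hopf_scalar c * H (word_ev w) + H (hopf_ev x)"
    using H w hopf_ev_in_loc_fractions[of x] loc_fractions_mult[OF loc_fractions_to_fract w]
    unfolding loc_linear_def by metis
  have "homotopy (y * (hopf_scalar c * hopf_mon w + x))
      = hopf_scalar c * (z * word_homotopy w + H (word_ev w)) + (z * homotopy x + H (hopf_ev x))"
    by (simp only: distrib_left[of y] scalar_left_commute homotopy_add homotopy_scalar mon add)
  also have "\<dots> = z * homotopy (hopf_scalar c * hopf_mon w + x)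
      + H (hopf_ev (hopf_scalar c * hopf_mon w + x))"
    unfolding hopf_ev_add hopf_ev_single homotopy_add homotopy_single H1
    by (simp add: distrib_left scalar_left_commute)
  finally show ?case .
qed

lemma loc_lin_powi_t:
  assumes "t_equivariant \<phi>"
  shows "loc_lin \<phi> (frac_t powi m) = \<phi> 0 0 * hopf_t m"
proof -
  have 1: "poly_lin \<phi> 1 = \<phi> 0 0"
    using poly_lin_const[of \<phi> 1] by (simp add: hopf_scalar_1 flip: one_pCons)
  show ?thesis
  proof (cases "m \<ge> 0")
    case True
    then have "frac_t powi m = to_fract (1 * (1 + poly_p * poly_q) ^ nat m) / frac_t ^ 0"
      by (simp only: to_fract_power power_int_def if_True mult_1 power_0 div_by_1)
    then have "loc_lin \<phi> (frac_t powi m) = \<phi> 0 0 * hopf_t (int (nat m)) * hopf_t (- int 0)"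
      by (simp only: loc_lin_eq[OF assms] poly_lin_t[OF assms] 1)
    with True show ?thesis by (simp add: hopf_t_0)
  next
    case False
    then have "frac_t powi m = to_fract 1 / frac_t ^ nat (- m)"
      by (simp only: power_int_def if_False to_fract_1 power_inverse)
        (simp only: divide_inverse mult_1)
    then have "loc_lin \<phi> (frac_t powi m) = \<phi> 0 0 * hopf_t (- int (nat (- m)))"
      by (simp only: loc_lin_eq[OF assms] 1)
    with False show ?thesis by simp
  qed
qed

text \<open>
  Left and right multiplication by \<open>t\<close> agree on the powers of \<open>t\<close>. This makes the rule for left
  multiplication by \<open>t\<^sup>m\<close> consistent with \<open>h(t\<^sup>n) = 0\<close>.
\<close>

lemma homotopy_t1_t: "homotopy_t1 (frac_t powi m) = 0"
proof -
  have "homotopy_q (frac_p * frac_t powi m) = hopf_a1 * hopf_t m"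
    by (simp only: loc_lin_p[OF t_equivariant_index(3) loc_fractions_t]
        loc_lin_powi_t[OF t_equivariant_p[OF t_equivariant_index(3)]])
      (simp add: q_index_def)
  then show ?thesis
    unfolding homotopy_t1_def
    by (simp add: loc_lin_powi_t t_equivariant_index p_index_def section_index_def
        del: to_fract_add to_fract_mult)
qed

lemma homotopy_t_t: "homotopy_t m (frac_t powi n) = 0"
  unfolding homotopy_t_def frac_t_powi_add[symmetric] homotopy_t1_t by simp

lemma homotopy_hopf_t: "homotopy (hopf_t m * x) = hopf_t m * homotopy x + homotopy_t m (hopf_ev x)"
proof (rule homotopy_mult_extend[OF loc_linear_homotopy_t])
  fix w
  show "homotopy (hopf_t m * hopf_mon w) = hopf_t m * word_homotopy w + homotopy_t m (word_ev w)"
    unfolding hopf_t_def hopf_mon_add[symmetric] homotopy_mon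
    unfolding hopf_t_def[symmetric]
    by (cases w)
      (simp_all only: plus_hopf_word.simps word_homotopy.simps word_ev.simps homotopy_t_t
        homotopy_t_cocycle hopf_t_add, simp_all add: algebra_simps)
qed

lemma homotopy_gen:
  "homotopy (hopf_gen g * x)
     = koszul_sign (int (gen_degree g)) * hopf_gen g * homotopy x + gen_homotopy g (hopf_ev x)"
proof (rule homotopy_mult_extend[OF loc_linear_gen_homotopy])
  fix w
  have "Tpow 0 + w = w" by (metis add_0 zero_hopf_word_def)
  then have "Gen 0 g (Tpow 0) + w = Gen 0 g w" by simp
  then show "homotopy (hopf_gen g * hopf_mon w)
      = koszul_sign (int (gen_degree g)) * hopf_gen g * word_homotopy w + gen_homotopy g (word_ev w)"
    unfolding hopf_gen_def hopf_mon_add[symmetric]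
    by (simp add: homotopy_mon homotopy_t_0 hopf_t_0 mult.assoc flip: hopf_gen_def)
qed

text \<open>
  This is the condition under which the letter \<open>a1\<close> needs no correction; it holds by the choice of
  \<open>homotopy_t1\<close>. The analogue for \<open>a2\<close> uses \<open>homotopy_t1_alt\<close>, hence the exchange identity.
\<close>

lemma homotopy_gen_d_A1:
  "homotopy (gen_d A1 * x) = gen_d A1 * homotopy x + hopf_a1 * loc_section (hopf_ev x)"
proof -
  have "homotopy_t 1 r = homotopy_t1 r" for r
    using homotopy_t_step[of 0 r] by (simp add: homotopy_t_0)
  then show ?thesis
    by (simp add: distrib_right left_diff_distrib homotopy_add homotopy_minus homotopy_hopf_t
        mult.assoc homotopy_gen hopf_ev_mult hopf_ev_gen homotopy_t1_def koszul_sign_def)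
      (simp add: algebra_simps)
qed

lemma homotopy_gen_d_A2:
  "homotopy (gen_d A2 * x) = gen_d A2 * homotopy x + hopf_a2 * loc_section (hopf_ev x)"
proof -
  have "homotopy_t 1 r = homotopy_t1 r" for r
    using homotopy_t_step[of 0 r] by (simp add: homotopy_t_0)
  then show ?thesis
    by (simp add: distrib_right left_diff_distrib homotopy_add homotopy_minus homotopy_hopf_t
        mult.assoc homotopy_gen hopf_ev_mult hopf_ev_gen koszul_sign_def
        homotopy_t1_alt[OF hopf_ev_in_loc_fractions])
      (simp add: algebra_simps)
qed

text \<open>
  The elements for which the contraction formula holds are closed under left multiplication by all
  letters. For \<open>t\<^sup>m\<close>, \<open>p\<close>, \<open>q\<close> this expresses that the corrections have the right boundary; for
  \<open>a1\<close>, \<open>a2\<close> it is the condition on \<open>h(d(a_i) x)\<close> above.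
\<close>

definition contracted :: "hopf_alg \<Rightarrow> bool" where
  "contracted x \<longleftrightarrow> explicit_d (homotopy x) + homotopy (explicit_d x) + loc_section (hopf_ev x) = x"

lemma contracted_t: "contracted x \<Longrightarrow> contracted (hopf_t m * x)"
proof -
  assume "contracted x"
  then have "hopf_t m * explicit_d (homotopy x) + hopf_t m * homotopy (explicit_d x)
      + hopf_t m * loc_section (hopf_ev x) = hopf_t m * x"
    unfolding contracted_def distrib_left[symmetric] by simp
  moreover have "homotopy_t m 0 = 0"
    using homotopy_t_cocycle[of 0 m 0] loc_linear_homotopy_t[of m] loc_fractions_0
    unfolding loc_linear_def by (metis add_cancel_right_right)
  ultimately show ?thesis
    unfolding contracted_def explicit_d_t_mult homotopy_hopf_t explicit_d_add
      explicit_d_homotopy_t[OF hopf_ev_in_loc_fractions] hopf_ev_mult hopf_ev_t hopf_ev_explicit_d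
    by (simp add: algebra_simps del: to_fract_add to_fract_mult)
qed

lemma contracted_gen: "contracted x \<Longrightarrow> contracted (hopf_gen g * x)"
proof -
  assume "contracted x"
  then have x: "explicit_d (homotopy x) = x - homotopy (explicit_d x) - loc_section (hopf_ev x)"
    unfolding contracted_def by (simp add: algebra_simps)
  have zero: "T 0 = 0" if "loc_linear T" for T
    using that loc_fractions_0 unfolding loc_linear_def by (metis add_cancel_right_right)
  note zeros = zero[OF loc_linear_loc_lin[OF t_equivariant_index(1)]]
    zero[OF loc_linear_loc_lin[OF t_equivariant_index(2)]]
    zero[OF loc_linear_loc_lin[OF t_equivariant_index(3)]]
  note r = hopf_ev_in_loc_fractions[of x]
  show ?thesis
  proof (cases g)
    case P
    show ?thesis
      unfolding contracted_def P
      by (simp add: homotopy_gen explicit_d_p explicit_d_add explicit_d_homotopy_p r zeros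
          hopf_ev_explicit_d hopf_ev_mult hopf_ev_gen koszul_sign_def x)
        (simp add: algebra_simps)
  next
    case Q
    show ?thesis
      unfolding contracted_def Q
      by (simp add: homotopy_gen explicit_d_q explicit_d_add explicit_d_homotopy_q r zeros
          hopf_ev_explicit_d hopf_ev_mult hopf_ev_gen koszul_sign_def x)
        (simp add: algebra_simps)
  next
    case A1
    show ?thesis
      unfolding contracted_def A1
      by (simp add: homotopy_gen explicit_d_a1 explicit_d_uminus homotopy_minus homotopy_gen_d_A1
          hopf_ev_mult hopf_ev_gen koszul_sign_def x zeros del: gen_d.simps)
        (simp add: algebra_simps del: gen_d.simps)
  next
    case A2
    show ?thesis
      unfolding contracted_def A2
      by (simp add: homotopy_gen explicit_d_a2 explicit_d_uminus homotopy_minus homotopy_gen_d_A2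
          hopf_ev_mult hopf_ev_gen koszul_sign_def x zeros del: gen_d.simps)
        (simp add: algebra_simps del: gen_d.simps)
  qed
qed

lemma contracted_mon: "contracted (hopf_mon w)"
proof (induction w)
  case (Tpow m)
  have "loc_section (frac_t powi m) = hopf_t m"
    by (simp only: loc_lin_powi_t[OF t_equivariant_index(1)]) (simp add: section_index_def)
  then show ?case
    unfolding contracted_def homotopy_mon hopf_ev_mon explicit_d_mon
    by (simp add: homotopy_0 explicit_d_0 hopf_mon_Tpow del: to_fract_add to_fract_mult)
next
  case (Gen m g w)
  then show ?case by (simp add: hopf_mon_Gen mult.assoc contracted_t contracted_gen)
qed

theorem contraction:
  "explicit_d (homotopy x) + homotopy (explicit_d x) + loc_section (hopf_ev x) = x"
proof -
  note lin = loc_linear_loc_lin[OF t_equivariant_index(1), unfolded loc_linear_def]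
  have "contracted x"
  proof (induction x rule: hopf_alg_induct)
    case zero
    have "loc_section 0 = 0" using lin loc_fractions_0 by (metis add_cancel_right_right)
    then show ?case by (simp add: contracted_def homotopy_0 explicit_d_0 hopf_ev_0)
  next
    case (add c w x)
    have 1: "loc_section (hopf_ev (hopf_scalar c * hopf_mon w + x))
        = hopf_scalar c * loc_section (word_ev w) + loc_section (hopf_ev x)"
      using lin hopf_ev_in_loc_fractions
      by (metis hopf_ev_add hopf_ev_scalar hopf_ev_mon)
    have 2: "hopf_scalar c * (explicit_d (word_homotopy w) + homotopy (word_d w)
        + loc_section (word_ev w)) = hopf_scalar c * hopf_mon w"
      using contracted_mon[of w] unfolding contracted_def
      by (simp only: homotopy_mon hopf_ev_mon explicit_d_mon)
    show ?case
      using add 2 unfolding contracted_def 1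
      by (simp add: homotopy_add homotopy_single explicit_d_add explicit_d_scalar explicit_d_single
          homotopy_scalar homotopy_mon explicit_d_mon algebra_simps)
  qed
  then show ?thesis by (simp only: contracted_def)
qed


section \<open>Localizations\<close>

lemma ring_of_type_algebra_simps [simp]:
  "carrier ring_of_type_algebra = UNIV"
  "x \<otimes>\<^bsub>ring_of_type_algebra\<^esub> y = x * y"
  "x \<oplus>\<^bsub>ring_of_type_algebra\<^esub> y = x + y"
  "\<one>\<^bsub>ring_of_type_algebra\<^esub> = 1"
  "\<zero>\<^bsub>ring_of_type_algebra\<^esub> = 0"
  by (simp_all add: ring_of_type_algebra_def)

locale multiplicative_system =
  fixes S :: "'a::comm_ring_1 set"
  assumes one_mem: "1 \<in> S" and mult_mem: "s \<in> S \<Longrightarrow> t \<in> S \<Longrightarrow> s * t \<in> S"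
begin

lemma rel_equiv: "equiv (UNIV \<times> S) (localization_rel S)"
  by (rule localization_rel_equiv) (fact one_mem mult_mem)+

lemma frac_mult:
  assumes "s \<in> S" "t \<in> S"
  shows "fraction S a s \<otimes>\<^bsub>localization S\<^esub> fraction S b t = fraction S (a * b) (s * t)"
  by (rule fraction_mult) (fact one_mem mult_mem assms)+

lemma frac_add:
  assumes "s \<in> S" "t \<in> S"
  shows "fraction S a s \<oplus>\<^bsub>localization S\<^esub> fraction S b t = fraction S (a * t + b * s) (s * t)"
  by (rule fraction_add) (fact one_mem mult_mem assms)+

lemma fraction_eqI: "s \<in> S \<Longrightarrow> t \<in> S \<Longrightarrow> a * t = b * s \<Longrightarrow> fraction S a s = fraction S b t"
  unfolding fraction_def
  by (rule equiv_class_eq[OF rel_equiv]) (use one_mem in \<open>auto simp: localization_rel_def\<close>)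

lemma carrier_localization: "carrier (localization S) = {fraction S a s | a s. s \<in> S}"
  unfolding localization_def quotient_def fraction_def by auto

lemma fraction_carrier: "s \<in> S \<Longrightarrow> fraction S a s \<in> carrier (localization S)"
  unfolding carrier_localization by blast

lemma localization_cases:
  assumes "x \<in> carrier (localization S)"
  obtains a s where "s \<in> S" "x = fraction S a s"
  using assms unfolding carrier_localization by blast

lemma one_localization: "\<one>\<^bsub>localization S\<^esub> = fraction S 1 1"
  and zero_localization: "\<zero>\<^bsub>localization S\<^esub> = fraction S 0 1"
  by (simp_all add: localization_def)

lemma cring_localization: "cring (localization S)"
proof (rule cringI)
  show "abelian_group (localization S)"
  proof (rule abelian_groupI)
    fix x y z
    assume "x \<in> carrier (localization S)" "y \<in> carrier (localization S)" "z \<in> carrier (localization S)"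
    then obtain a s b t c u where x: "x = fraction S a s" "y = fraction S b t" "z = fraction S c u"
      and S: "s \<in> S" "t \<in> S" "u \<in> S"
      by (elim localization_cases) blast
    show "x \<oplus>\<^bsub>localization S\<^esub> y \<oplus>\<^bsub>localization S\<^esub> z
        = x \<oplus>\<^bsub>localization S\<^esub> (y \<oplus>\<^bsub>localization S\<^esub> z)"
      unfolding x by (simp add: frac_add S mult_mem algebra_simps)
  next
    fix x y
    assume "x \<in> carrier (localization S)" "y \<in> carrier (localization S)"
    then obtain a s b t where x: "x = fraction S a s" "y = fraction S b t"
      and S: "s \<in> S" "t \<in> S"
      by (elim localization_cases) blast
    show "x \<oplus>\<^bsub>localization S\<^esub> y = y \<oplus>\<^bsub>localization S\<^esub> x"
      unfolding x by (simp add: frac_add S mult_mem algebra_simps)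
    show "x \<oplus>\<^bsub>localization S\<^esub> y \<in> carrier (localization S)"
      unfolding x by (simp add: frac_add S mult_mem fraction_carrier)
  next
    fix x
    assume "x \<in> carrier (localization S)"
    then obtain a s where x: "x = fraction S a s" and S: "s \<in> S"
      by (elim localization_cases) blast
    show "\<zero>\<^bsub>localization S\<^esub> \<oplus>\<^bsub>localization S\<^esub> x = x"
      unfolding x by (simp add: frac_add S one_mem zero_localization)
    have "fraction S (- a) s \<oplus>\<^bsub>localization S\<^esub> x = \<zero>\<^bsub>localization S\<^esub>"
      unfolding x zero_localization frac_add[OF S S]
      by (rule fraction_eqI) (simp_all add: S mult_mem one_mem)
    then show "\<exists>y\<in>carrier (localization S). y \<oplus>\<^bsub>localization S\<^esub> x = \<zero>\<^bsub>localization S\<^esub>"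
      using fraction_carrier[OF S] by blast
  qed (simp add: zero_localization fraction_carrier one_mem)
next
  show "comm_monoid (localization S)"
  proof (rule comm_monoidI)
    fix x y z
    assume "x \<in> carrier (localization S)" "y \<in> carrier (localization S)" "z \<in> carrier (localization S)"
    then obtain a s b t c u where x: "x = fraction S a s" "y = fraction S b t" "z = fraction S c u"
      and S: "s \<in> S" "t \<in> S" "u \<in> S"
      by (elim localization_cases) blast
    show "x \<otimes>\<^bsub>localization S\<^esub> y \<otimes>\<^bsub>localization S\<^esub> z
        = x \<otimes>\<^bsub>localization S\<^esub> (y \<otimes>\<^bsub>localization S\<^esub> z)"
      unfolding x by (simp add: frac_mult S mult_mem algebra_simps)
  next
    fix x y
    assume "x \<in> carrier (localization S)" "y \<in> carrier (localization S)"
    then obtain a s b t where x: "x = fraction S a s" "y = fraction S b t"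
      and S: "s \<in> S" "t \<in> S"
      by (elim localization_cases) blast
    show "x \<otimes>\<^bsub>localization S\<^esub> y = y \<otimes>\<^bsub>localization S\<^esub> x"
      unfolding x by (simp add: frac_mult S mult_mem algebra_simps)
    show "x \<otimes>\<^bsub>localization S\<^esub> y \<in> carrier (localization S)"
      unfolding x by (simp add: frac_mult S mult_mem fraction_carrier)
  next
    fix x
    assume "x \<in> carrier (localization S)"
    then obtain a s where x: "x = fraction S a s" and S: "s \<in> S"
      by (elim localization_cases) blast
    show "\<one>\<^bsub>localization S\<^esub> \<otimes>\<^bsub>localization S\<^esub> x = x"
      unfolding x by (simp add: frac_mult S one_mem one_localization)
  qed (simp add: one_localization fraction_carrier one_mem)
next
  fix x y z
  assume "x \<in> carrier (localization S)" "y \<in> carrier (localization S)" "z \<in> carrier (localization S)"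
  then obtain a s b t c u where x: "x = fraction S a s" "y = fraction S b t" "z = fraction S c u"
    and S: "s \<in> S" "t \<in> S" "u \<in> S"
    by (elim localization_cases) blast
  show "(x \<oplus>\<^bsub>localization S\<^esub> y) \<otimes>\<^bsub>localization S\<^esub> z
      = x \<otimes>\<^bsub>localization S\<^esub> z \<oplus>\<^bsub>localization S\<^esub> y \<otimes>\<^bsub>localization S\<^esub> z"
    unfolding x by (simp add: frac_add frac_mult S mult_mem)
      (rule fraction_eqI, simp_all add: S mult_mem algebra_simps)
qed

lemma canonical_hom: "(\<lambda>a. fraction S a 1) \<in> ring_hom ring_of_type_algebra (localization S)"
  by (rule ring_hom_memI)
    (simp_all add: fraction_carrier one_mem frac_add frac_mult one_localization)

lemma fraction_denominator:
  assumes "s \<in> S"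
  shows "fraction S a s \<otimes>\<^bsub>localization S\<^esub> fraction S s 1 = fraction S a 1"
  unfolding frac_mult[OF assms one_mem]
  by (rule fraction_eqI) (simp_all add: assms one_mem)

text \<open>
  A homomorphism is determined by its values on numerators, since the value at \<open>1/s\<close> has to be the
  inverse of the value at \<open>s\<close>.
\<close>

lemma localization_hom_eq:
  assumes B: "ring B"
    and f: "f \<in> ring_hom (localization S) B" and g: "g \<in> ring_hom (localization S) B"
    and eq: "\<And>a. f (fraction S a 1) = g (fraction S a 1)"
    and x: "x \<in> carrier (localization S)"
  shows "f x = g x"
proof -
  interpret B: ring B by fact
  obtain a s where s: "s \<in> S" and xs: "x = fraction S a s" using x by (rule localization_cases)
  let ?u = "fraction S s 1" and ?v = "fraction S 1 s"
  \<comment> \<open>\<open>?v\<close> is the inverse of \<open>?u\<close>, and \<open>x\<close> is a numerator times \<open>?v\<close>.\<close>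
  have uv: "?u \<otimes>\<^bsub>localization S\<^esub> ?v = \<one>\<^bsub>localization S\<^esub>"
    unfolding frac_mult[OF one_mem s] one_localization
    by (rule fraction_eqI) (simp_all add: s one_mem)
  have c: "?u \<in> carrier (localization S)" "?v \<in> carrier (localization S)"
    using fraction_carrier s one_mem by auto
  have vu: "?v \<otimes>\<^bsub>localization S\<^esub> ?u = \<one>\<^bsub>localization S\<^esub>"
    using uv unfolding frac_mult[OF one_mem s] frac_mult[OF s one_mem] by simp
  have inverse: "h ?u \<otimes>\<^bsub>B\<^esub> h ?v = \<one>\<^bsub>B\<^esub>" "h ?v \<otimes>\<^bsub>B\<^esub> h ?u = \<one>\<^bsub>B\<^esub>"
    if h: "h \<in> ring_hom (localization S) B" for h
    using ring_hom_mult[OF h c] ring_hom_mult[OF h c(2,1)] ring_hom_one[OF h]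
    unfolding uv vu by metis+
  have at_x: "h x = h (fraction S a 1) \<otimes>\<^bsub>B\<^esub> h ?v" if h: "h \<in> ring_hom (localization S) B" for h
  proof -
    note closed = ring_hom_closed[OF h x] ring_hom_closed[OF h c(1)] ring_hom_closed[OF h c(2)]
    have "h (fraction S a 1) = h x \<otimes>\<^bsub>B\<^esub> h ?u"
      using ring_hom_mult[OF h x c(1)] fraction_denominator[OF s, of a] unfolding xs by simp
    then have "h (fraction S a 1) \<otimes>\<^bsub>B\<^esub> h ?v = h x \<otimes>\<^bsub>B\<^esub> (h ?u \<otimes>\<^bsub>B\<^esub> h ?v)"
      using B.m_assoc[OF closed] by simp
    then show ?thesis unfolding inverse(1)[OF h] using B.r_one[OF closed(1)] by simp
  qed
  have "g ?v \<otimes>\<^bsub>B\<^esub> f ?u = \<one>\<^bsub>B\<^esub>" using inverse(2)[OF g] eq[of s] by simp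
  then have "g ?v = f ?v"
    using B.inv_unique[OF _ inverse(1)[OF f]] ring_hom_closed[OF f c(1)] ring_hom_closed[OF f c(2)]
      ring_hom_closed[OF g c(2)] by blast
  then show ?thesis using at_x[OF f] at_x[OF g] eq[of a] by simp
qed

text \<open>
  The homomorphism given by the universal property. The set of values over all representatives of a
  fraction is a singleton when \<open>\<psi>\<close> sends denominators to units.
\<close>

definition localization_lift :: "('a \<Rightarrow> 'b) \<Rightarrow> 'b ring \<Rightarrow> ('a \<times> 'a) set \<Rightarrow> 'b" where
  "localization_lift \<psi> B x = the_elem ((\<lambda>(a, s). \<psi> a \<otimes>\<^bsub>B\<^esub> inv\<^bsub>B\<^esub> (\<psi> s)) ` x)"

context
  fixes B :: "'b ring" and \<psi>
  assumes B: "cring B" and \<psi>: "\<psi> \<in> ring_hom ring_of_type_algebra B"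
    and units: "\<And>s. s \<in> S \<Longrightarrow> \<psi> s \<in> Units B"
begin

interpretation B: cring B by (rule B)

lemma psi_closed [simp]: "\<psi> a \<in> carrier B"
  using ring_hom_closed[OF \<psi>] by simp

lemma psi_mult: "\<psi> (a * b) = \<psi> a \<otimes>\<^bsub>B\<^esub> \<psi> b"
  and psi_add: "\<psi> (a + b) = \<psi> a \<oplus>\<^bsub>B\<^esub> \<psi> b"
  and psi_one: "\<psi> 1 = \<one>\<^bsub>B\<^esub>"
  using ring_hom_mult[OF \<psi>, of a b] ring_hom_add[OF \<psi>, of a b] ring_hom_one[OF \<psi>] by simp_all

lemma localization_lift_unique:
  assumes s: "s \<in> S" and b: "b \<in> carrier B" "b \<otimes>\<^bsub>B\<^esub> \<psi> s = \<psi> a"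
  shows "\<psi> a \<otimes>\<^bsub>B\<^esub> inv\<^bsub>B\<^esub> (\<psi> s) = b"
  using units[OF s] b(1) by (simp add: B.m_assoc flip: b(2))

lemma localization_lift_cancel:
  "s \<in> S \<Longrightarrow> \<psi> a \<otimes>\<^bsub>B\<^esub> inv\<^bsub>B\<^esub> (\<psi> s) \<otimes>\<^bsub>B\<^esub> \<psi> s = \<psi> a"
  using units by (simp add: B.m_assoc)

lemma localization_lift_fraction:
  assumes s: "s \<in> S"
  shows "localization_lift \<psi> B (fraction S a s) = \<psi> a \<otimes>\<^bsub>B\<^esub> inv\<^bsub>B\<^esub> (\<psi> s)"
proof -
  have "\<psi> b \<otimes>\<^bsub>B\<^esub> inv\<^bsub>B\<^esub> (\<psi> t) = \<psi> a \<otimes>\<^bsub>B\<^esub> inv\<^bsub>B\<^esub> (\<psi> s)"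
    if "(b, t) \<in> fraction S a s" for b t
  proof -
    from that obtain u where t: "t \<in> S" and u: "u \<in> S" "u * (a * t - b * s) = 0"
      unfolding fraction_def localization_rel_def by auto
    from u(2) have "u * (b * s) = u * (a * t)" by (simp add: algebra_simps)
    then have "\<psi> u \<otimes>\<^bsub>B\<^esub> (\<psi> b \<otimes>\<^bsub>B\<^esub> \<psi> s) = \<psi> u \<otimes>\<^bsub>B\<^esub> (\<psi> a \<otimes>\<^bsub>B\<^esub> \<psi> t)"
      by (metis psi_mult)
    then have bs: "\<psi> b \<otimes>\<^bsub>B\<^esub> \<psi> s = \<psi> a \<otimes>\<^bsub>B\<^esub> \<psi> t" using units[OF u(1)] by simp
    have "\<psi> a \<otimes>\<^bsub>B\<^esub> inv\<^bsub>B\<^esub> (\<psi> s) \<otimes>\<^bsub>B\<^esub> \<psi> t = \<psi> a \<otimes>\<^bsub>B\<^esub> \<psi> t \<otimes>\<^bsub>B\<^esub> inv\<^bsub>B\<^esub> (\<psi> s)"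
      using units[OF s] by (simp add: B.m_ac)
    also have "\<dots> = \<psi> b"
      using units[OF s] by (simp add: B.m_assoc flip: bs)
    finally show ?thesis
      using units[OF s] by (intro localization_lift_unique[OF t]) simp_all
  qed
  then have "(case y of (a, s) \<Rightarrow> \<psi> a \<otimes>\<^bsub>B\<^esub> inv\<^bsub>B\<^esub> (\<psi> s))
      = (case (a, s) of (a, s) \<Rightarrow> \<psi> a \<otimes>\<^bsub>B\<^esub> inv\<^bsub>B\<^esub> (\<psi> s))" if "y \<in> fraction S a s" for y
    using that by (cases y) (simp only: prod.case)
  moreover have "(a, s) \<in> fraction S a s"
    unfolding fraction_def localization_rel_def using s one_mem by auto
  ultimately have "localization_lift \<psi> B (fraction S a s)
      = (case (a, s) of (a, s) \<Rightarrow> \<psi> a \<otimes>\<^bsub>B\<^esub> inv\<^bsub>B\<^esub> (\<psi> s))"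
    unfolding localization_lift_def by (intro the_elem_image_unique) blast+
  then show ?thesis by (simp only: prod.case)
qed

lemma localization_lift_canonical: "localization_lift \<psi> B (fraction S a 1) = \<psi> a"
  by (simp add: localization_lift_fraction one_mem psi_one)

lemma localization_lift_hom: "localization_lift \<psi> B \<in> ring_hom (localization S) B"
proof (rule ring_hom_memI)
  fix x assume "x \<in> carrier (localization S)"
  then show "localization_lift \<psi> B x \<in> carrier B"
    by (elim localization_cases) (simp add: localization_lift_fraction units)
next
  fix x y assume "x \<in> carrier (localization S)" "y \<in> carrier (localization S)"
  then obtain a s b t where x: "x = fraction S a s" "y = fraction S b t" and S: "s \<in> S" "t \<in> S"
    by (elim localization_cases) blast
  let ?x = "\<psi> a \<otimes>\<^bsub>B\<^esub> inv\<^bsub>B\<^esub> (\<psi> s)" and ?y = "\<psi> b \<otimes>\<^bsub>B\<^esub> inv\<^bsub>B\<^esub> (\<psi> t)"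
  note closed = units[OF S(1)] units[OF S(2)]
  have c: "?x \<in> carrier B" "?y \<in> carrier B" using closed by auto
  have x1: "?x \<otimes>\<^bsub>B\<^esub> \<psi> s = \<psi> a" and y1: "?y \<otimes>\<^bsub>B\<^esub> \<psi> t = \<psi> b"
    using S localization_lift_cancel by auto
  \<comment> \<open>The product and the sum of the images are recognized by multiplying them with the image of the
    common denominator.\<close>
  have "?x \<otimes>\<^bsub>B\<^esub> ?y \<otimes>\<^bsub>B\<^esub> \<psi> (s * t) = (?x \<otimes>\<^bsub>B\<^esub> \<psi> s) \<otimes>\<^bsub>B\<^esub> (?y \<otimes>\<^bsub>B\<^esub> \<psi> t)"
    unfolding psi_mult using c by (simp only: B.m_ac B.m_closed psi_closed)
  then have m: "?x \<otimes>\<^bsub>B\<^esub> ?y \<otimes>\<^bsub>B\<^esub> \<psi> (s * t) = \<psi> (a * b)" unfolding x1 y1 psi_mult .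
  have "(?x \<oplus>\<^bsub>B\<^esub> ?y) \<otimes>\<^bsub>B\<^esub> \<psi> (s * t)
      = (?x \<otimes>\<^bsub>B\<^esub> \<psi> s) \<otimes>\<^bsub>B\<^esub> \<psi> t \<oplus>\<^bsub>B\<^esub> (?y \<otimes>\<^bsub>B\<^esub> \<psi> t) \<otimes>\<^bsub>B\<^esub> \<psi> s"
    unfolding psi_mult using c by (simp only: B.l_distr B.m_ac B.m_closed psi_closed)
  then have p: "(?x \<oplus>\<^bsub>B\<^esub> ?y) \<otimes>\<^bsub>B\<^esub> \<psi> (s * t) = \<psi> (a * t + b * s)"
    unfolding x1 y1 psi_mult psi_add .
  show "localization_lift \<psi> B (x \<otimes>\<^bsub>localization S\<^esub> y)
      = localization_lift \<psi> B x \<otimes>\<^bsub>B\<^esub> localization_lift \<psi> B y"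
    unfolding x frac_mult[OF S]
    by (simp only: localization_lift_fraction[OF S(1)] localization_lift_fraction[OF S(2)]
        localization_lift_fraction[OF mult_mem[OF S]]
        localization_lift_unique[OF mult_mem[OF S] B.m_closed[OF c] m])
  show "localization_lift \<psi> B (x \<oplus>\<^bsub>localization S\<^esub> y)
      = localization_lift \<psi> B x \<oplus>\<^bsub>B\<^esub> localization_lift \<psi> B y"
    unfolding x frac_add[OF S]
    by (simp only: localization_lift_fraction[OF S(1)] localization_lift_fraction[OF S(2)]
        localization_lift_fraction[OF mult_mem[OF S]]
        localization_lift_unique[OF mult_mem[OF S] B.a_closed[OF c] p])
next
  show "localization_lift \<psi> B \<one>\<^bsub>localization S\<^esub> = \<one>\<^bsub>B\<^esub>"
    by (simp add: one_localization localization_lift_canonical psi_one)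
qed

end

end

section \<open>Evaluation of polynomials in a commutative ring\<close>

text \<open>
  Horner's scheme for \<open>f(b)\<close>, where \<open>\<psi>\<close> is applied to the coefficients. A homomorphism out of
  \<open>\<complex>[p][q]\<close> arises by taking for \<open>\<psi>\<close> such an evaluation at the image of \<open>p\<close>.
\<close>

definition poly_eval :: "('a::zero \<Rightarrow> 'b) \<Rightarrow> 'b ring \<Rightarrow> 'b \<Rightarrow> 'a poly \<Rightarrow> 'b" where
  "poly_eval \<psi> B b f = fold_coeffs (\<lambda>a x. \<psi> a \<oplus>\<^bsub>B\<^esub> b \<otimes>\<^bsub>B\<^esub> x) f \<zero>\<^bsub>B\<^esub>"

context
  fixes B :: "'b ring" and \<psi> :: "'a::comm_ring_1 \<Rightarrow> 'b" and b :: 'b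
  assumes B: "cring B" and \<psi>: "\<psi> \<in> ring_hom ring_of_type_algebra B" and b: "b \<in> carrier B"
begin

interpretation B: cring B by (rule B)

lemma eval_psi_closed: "\<psi> a \<in> carrier B"
  using ring_hom_closed[OF \<psi>] by simp

lemma eval_psi_zero: "\<psi> 0 = \<zero>\<^bsub>B\<^esub>"
proof -
  have "\<psi> 0 \<oplus>\<^bsub>B\<^esub> \<psi> 0 = \<psi> 0" using ring_hom_add[OF \<psi>, of 0 0] by simp
  then show ?thesis using B.add.r_cancel_one[OF eval_psi_closed eval_psi_closed] by simp
qed

lemma poly_eval_0: "poly_eval \<psi> B b 0 = \<zero>\<^bsub>B\<^esub>"
  by (simp add: poly_eval_def)

lemma poly_eval_pCons: "poly_eval \<psi> B b (pCons a f) = \<psi> a \<oplus>\<^bsub>B\<^esub> b \<otimes>\<^bsub>B\<^esub> poly_eval \<psi> B b f"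
  using b by (cases "f = 0"; cases "a = 0") (simp_all add: poly_eval_def eval_psi_zero)

lemma poly_eval_closed: "poly_eval \<psi> B b f \<in> carrier B"
  by (induction f) (simp_all add: poly_eval_0 poly_eval_pCons b eval_psi_closed)

lemma poly_eval_const: "poly_eval \<psi> B b [:a:] = \<psi> a"
  by (simp add: poly_eval_0 poly_eval_pCons b eval_psi_closed)

lemma poly_eval_X: "poly_eval \<psi> B b [:0, 1:] = b"
  using ring_hom_one[OF \<psi>] by (simp add: poly_eval_0 poly_eval_pCons b eval_psi_zero)

lemma poly_eval_add: "poly_eval \<psi> B b (f + g) = poly_eval \<psi> B b f \<oplus>\<^bsub>B\<^esub> poly_eval \<psi> B b g"
proof (induction f arbitrary: g)
  case 0
  then show ?case by (simp add: poly_eval_0 poly_eval_closed)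
next
  case (pCons a f)
  obtain c g' where g: "g = pCons c g'" by (cases g)
  have "\<psi> (a + c) = \<psi> a \<oplus>\<^bsub>B\<^esub> \<psi> c" using ring_hom_add[OF \<psi>, of a c] by simp
  then show ?case
    unfolding g
    by (simp add: pCons.IH poly_eval_pCons b eval_psi_closed poly_eval_closed B.r_distr B.a_ac)
qed

lemma poly_eval_smult: "poly_eval \<psi> B b (smult a f) = \<psi> a \<otimes>\<^bsub>B\<^esub> poly_eval \<psi> B b f"
proof (induction f)
  case 0
  then show ?case by (simp add: poly_eval_0 eval_psi_closed)
next
  case (pCons c f)
  have "\<psi> (a * c) = \<psi> a \<otimes>\<^bsub>B\<^esub> \<psi> c" using ring_hom_mult[OF \<psi>, of a c] by simp
  with pCons show ?case
    by (simp add: poly_eval_pCons b eval_psi_closed poly_eval_closed B.r_distr B.m_ac)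
qed

lemma poly_eval_mult: "poly_eval \<psi> B b (f * g) = poly_eval \<psi> B b f \<otimes>\<^bsub>B\<^esub> poly_eval \<psi> B b g"
proof (induction f)
  case 0
  then show ?case by (simp add: poly_eval_0 poly_eval_closed)
next
  case (pCons a f)
  then show ?case
    by (simp add: poly_eval_add poly_eval_smult poly_eval_pCons b eval_psi_closed eval_psi_zero
        poly_eval_closed B.l_distr B.m_assoc)
qed

lemma poly_eval_hom: "poly_eval \<psi> B b \<in> ring_hom ring_of_type_algebra B"
proof (rule ring_hom_memI)
  show "poly_eval \<psi> B b \<one>\<^bsub>ring_of_type_algebra\<^esub> = \<one>\<^bsub>B\<^esub>"
    using ring_hom_one[OF \<psi>] by (simp add: one_pCons poly_eval_const)
qed (simp_all add: poly_eval_closed poly_eval_add poly_eval_mult)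

end

section \<open>The localization is a smooth affine algebra\<close>

lemma poly_pq_induct [case_names const add p q]:
  assumes const: "\<And>c. R [:[:c:]:]" and add: "\<And>f g. R f \<Longrightarrow> R g \<Longrightarrow> R (f + g)"
    and p: "\<And>f. R f \<Longrightarrow> R (poly_p * f)" and q: "\<And>f. R f \<Longrightarrow> R (poly_q * f)"
  shows "R f"
proof -
  have inner: "R [:a:]" for a
  proof (induction a)
    case 0
    then show ?case using const[of 0] by simp
  next
    case (pCons c a)
    have "[:pCons c a:] = [:[:c:]:] + poly_p * [:a:]" by (simp add: poly_p_def)
    then show ?case using add[OF const p[OF pCons.IH]] by simp
  qed
  show ?thesis
  proof (induction f)
    case 0
    then show ?case using inner[of 0] by simp
  next
    case (pCons a f)
    have "pCons a f = [:a:] + poly_q * f" by (simp add: poly_q_def)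
    then show ?case using add[OF inner q[OF pCons.IH]] by simp
  qed
qed

lemma poly_pq_hom_eq:
  assumes f: "f \<in> ring_hom ring_of_type_algebra B" and g: "g \<in> ring_hom ring_of_type_algebra B"
    and const: "\<And>c. f [:[:c:]:] = g [:[:c:]:]" and p: "f poly_p = g poly_p" and q: "f poly_q = g poly_q"
  shows "f x = g x"
proof -
  have add: "h (y + z) = h y \<oplus>\<^bsub>B\<^esub> h z" and mult: "h (y * z) = h y \<otimes>\<^bsub>B\<^esub> h z"
    if "h \<in> ring_hom ring_of_type_algebra B" for h y z
    using ring_hom_add[OF that] ring_hom_mult[OF that] by simp_all
  show ?thesis
    by (induction x rule: poly_pq_induct)
      (simp_all add: const p q add[OF f] add[OF g] mult[OF f] mult[OF g])
qed

interpretation hopf: multiplicative_system hopf_denominators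
  by unfold_locales (fact hopf_denominators_one hopf_denominators_mult)+

lemma hopf_denominators_power: "(1 + poly_p * poly_q) ^ n \<in> hopf_denominators"
  unfolding hopf_denominators_def by blast

lemma cring_hopf_localization: "cring hopf_localization"
  unfolding hopf_localization_def by (rule hopf.cring_localization)

lemma hopf_frac_hom: "hopf_frac \<in> ring_hom ring_of_type_algebra hopf_localization"
  using hopf.canonical_hom unfolding hopf_localization_def hopf_frac_def[abs_def] .

lemma complex_cring_algebra_hopf_localization:
  "complex_cring_algebra hopf_localization (\<lambda>c. hopf_frac [:[:c:]:])"
proof -
  have "(\<lambda>c. hopf_frac [:[:c:]:]) \<in> ring_hom complex_ring hopf_localization"
  proof (rule ring_hom_memI)
    fix a b :: complex
    show "hopf_frac [:[:a:]:] \<in> carrier hopf_localization"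
      using ring_hom_closed[OF hopf_frac_hom] by simp
    show "hopf_frac [:[:a \<otimes>\<^bsub>complex_ring\<^esub> b:]:]
        = hopf_frac [:[:a:]:] \<otimes>\<^bsub>hopf_localization\<^esub> hopf_frac [:[:b:]:]"
      using ring_hom_mult[OF hopf_frac_hom, of "[:[:a:]:]" "[:[:b:]:]"] by simp
    show "hopf_frac [:[:a \<oplus>\<^bsub>complex_ring\<^esub> b:]:]
        = hopf_frac [:[:a:]:] \<oplus>\<^bsub>hopf_localization\<^esub> hopf_frac [:[:b:]:]"
      using ring_hom_add[OF hopf_frac_hom, of "[:[:a:]:]" "[:[:b:]:]"] by simp
    show "hopf_frac [:[:\<one>\<^bsub>complex_ring\<^esub>:]:] = \<one>\<^bsub>hopf_localization\<^esub>"
      using ring_hom_one[OF hopf_frac_hom] by (simp flip: one_pCons)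
  qed
  then show ?thesis unfolding complex_cring_algebra_def using cring_hopf_localization by blast
qed

lemma affine_algebra_hopf_localization:
  "affine_algebra hopf_localization (\<lambda>c. hopf_frac [:[:c:]:])"
proof -
  let ?v = "fraction hopf_denominators 1 (1 + poly_p * poly_q)"
  let ?G = "{hopf_frac poly_p, hopf_frac poly_q, ?v}"
  let ?A = "generate_ring hopf_localization (range (\<lambda>c. hopf_frac [:[:c:]:]) \<union> ?G)"
  interpret L: cring hopf_localization by (rule cring_hopf_localization)
  have t: "1 + poly_p * poly_q \<in> hopf_denominators" using hopf_denominators_power[of 1] by simp
  have frac: "hopf_frac f \<in> carrier hopf_localization" for f
    using ring_hom_closed[OF hopf_frac_hom] by simp
  have G: "?G \<subseteq> carrier hopf_localization"
    using frac hopf.fraction_carrier[OF t] by (simp add: hopf_localization_def)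
  have poly: "hopf_frac f \<in> ?A" for f
  proof (induction f rule: poly_pq_induct)
    case (add f g)
    then show ?case
      using generate_ring.eng_add ring_hom_add[OF hopf_frac_hom, of f g] by fastforce
  next
    case (p f)
    have "hopf_frac poly_p \<in> ?A" by (rule generate_ring.incl) simp
    from generate_ring.eng_mult[OF this p]
    show ?case using ring_hom_mult[OF hopf_frac_hom, of poly_p f] by simp
  next
    case (q f)
    have "hopf_frac poly_q \<in> ?A" by (rule generate_ring.incl) simp
    from generate_ring.eng_mult[OF this q]
    show ?case using ring_hom_mult[OF hopf_frac_hom, of poly_q f] by simp
  qed (rule generate_ring.incl, simp)
  have frac_power: "fraction hopf_denominators f ((1 + poly_p * poly_q) ^ n) \<in> ?A" for f n
  proof (induction n)
    case 0
    then show ?case using poly[of f] by (simp add: hopf_frac_def)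
  next
    case (Suc n)
    have "?v \<in> ?A" by (rule generate_ring.incl) simp
    from generate_ring.eng_mult[OF this Suc]
    show ?case
      by (simp only: hopf_localization_def hopf.frac_mult[OF t hopf_denominators_power] mult_1 power_Suc)
  qed
  have "carrier hopf_localization \<subseteq> ?A"
  proof
    fix x assume "x \<in> carrier hopf_localization"
    then obtain a s where "s \<in> hopf_denominators" "x = fraction hopf_denominators a s"
      unfolding hopf_localization_def by (rule hopf.localization_cases)
    then show "x \<in> ?A" using frac_power unfolding hopf_denominators_def by auto
  qed
  moreover have "?A \<subseteq> carrier hopf_localization"
    using G frac by (intro L.generate_ring_incl) auto
  ultimately have "?A = carrier hopf_localization" by blast
  then show ?thesis
    unfolding affine_algebra_def using complex_cring_algebra_hopf_localization G
    by (intro conjI exI[of _ ?G]) simp_all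
qed

text \<open>
  If \<open>u v = 1 + e\<close> with \<open>e\<^sup>2 = 0\<close>, then \<open>v (1 - e)\<close> is an inverse of \<open>u\<close>.
\<close>

lemma unit_lift_square_zero:
  assumes "cring B" "ideal I B" and sq: "\<And>x y. x \<in> I \<Longrightarrow> y \<in> I \<Longrightarrow> x \<otimes>\<^bsub>B\<^esub> y = \<zero>\<^bsub>B\<^esub>"
    and u: "u \<in> carrier B" and v: "v \<in> carrier B"
    and uv: "I +>\<^bsub>B\<^esub> (u \<otimes>\<^bsub>B\<^esub> v) = I +>\<^bsub>B\<^esub> \<one>\<^bsub>B\<^esub>"
  shows "u \<in> Units B"
proof -
  interpret B: cring B by fact
  interpret I: ideal I B by fact
  have "u \<otimes>\<^bsub>B\<^esub> v \<in> I +>\<^bsub>B\<^esub> \<one>\<^bsub>B\<^esub>"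
    using uv I.a_rcos_self[of "u \<otimes>\<^bsub>B\<^esub> v"] u v by auto
  then obtain e where e: "e \<in> I" and uve: "u \<otimes>\<^bsub>B\<^esub> v = e \<oplus>\<^bsub>B\<^esub> \<one>\<^bsub>B\<^esub>"
    unfolding a_r_coset_def' by blast
  have ec: "e \<in> carrier B" using e I.a_subset by blast
  have "u \<otimes>\<^bsub>B\<^esub> (v \<otimes>\<^bsub>B\<^esub> (\<one>\<^bsub>B\<^esub> \<ominus>\<^bsub>B\<^esub> e)) = (e \<oplus>\<^bsub>B\<^esub> \<one>\<^bsub>B\<^esub>) \<otimes>\<^bsub>B\<^esub> (\<one>\<^bsub>B\<^esub> \<ominus>\<^bsub>B\<^esub> e)"
    using u v ec by (simp add: uve flip: B.m_assoc)
  also have "\<dots> = \<one>\<^bsub>B\<^esub> \<ominus>\<^bsub>B\<^esub> e \<otimes>\<^bsub>B\<^esub> e"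
    using ec by algebra
  also have "\<dots> = \<one>\<^bsub>B\<^esub>" using sq[OF e e] by (simp add: a_minus_def)
  finally have "u \<otimes>\<^bsub>B\<^esub> (v \<otimes>\<^bsub>B\<^esub> (\<one>\<^bsub>B\<^esub> \<ominus>\<^bsub>B\<^esub> e)) = \<one>\<^bsub>B\<^esub>" .
  moreover have "v \<otimes>\<^bsub>B\<^esub> (\<one>\<^bsub>B\<^esub> \<ominus>\<^bsub>B\<^esub> e) \<in> carrier B" using v ec by simp
  ultimately show ?thesis
    using u B.m_comm[of u] unfolding Units_def by (intro CollectI conjI bexI) simp_all
qed

text \<open>
  The lift is the evaluation at arbitrary preimages of the images of \<open>p\<close> and \<open>q\<close>. It induces the given
  map modulo \<open>I\<close> because a homomorphism out of the localization is determined by its values on the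
  constants, \<open>p\<close> and \<open>q\<close>.
\<close>

lemma formally_smooth_hopf_localization:
  "formally_smooth TYPE('b) hopf_localization (\<lambda>c. hopf_frac [:[:c:]:])"
  unfolding formally_smooth_def
proof (intro allI impI)
  fix B :: "'b ring" and \<beta> I f
  assume B: "complex_cring_algebra B \<beta>" and I: "ideal I B"
    and sq: "\<forall>x\<in>I. \<forall>y\<in>I. x \<otimes>\<^bsub>B\<^esub> y = \<zero>\<^bsub>B\<^esub>"
    and f: "f \<in> ring_hom hopf_localization (B Quot I)"
    and f\<beta>: "\<forall>c. f (hopf_frac [:[:c:]:]) = I +>\<^bsub>B\<^esub> \<beta> c"
  have Bc: "cring B" and \<beta>: "\<beta> \<in> ring_hom complex_ring B"
    using B unfolding complex_cring_algebra_def by auto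
  interpret B: cring B by (rule Bc)
  interpret I: ideal I B by (rule I)
  interpret L: cring hopf_localization by (rule cring_hopf_localization)
  have lift: "\<exists>b\<in>carrier B. f x = I +>\<^bsub>B\<^esub> b" if "x \<in> carrier hopf_localization" for x
    using ring_hom_closed[OF f that] by (auto simp: FactRing_def A_RCOSETS_def')
  have frac: "hopf_frac g \<in> carrier hopf_localization" for g
    using ring_hom_closed[OF hopf_frac_hom] by simp
  obtain bp where bp: "bp \<in> carrier B" "f (hopf_frac poly_p) = I +>\<^bsub>B\<^esub> bp" using lift[OF frac] by blast
  obtain bq where bq: "bq \<in> carrier B" "f (hopf_frac poly_q) = I +>\<^bsub>B\<^esub> bq" using lift[OF frac] by blast
  define \<psi>1 where "\<psi>1 = poly_eval \<beta> B bp"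
  define \<psi> where "\<psi> = poly_eval \<psi>1 B bq"
  have \<psi>1: "\<psi>1 \<in> ring_hom ring_of_type_algebra B"
    unfolding \<psi>1_def by (rule poly_eval_hom[OF Bc \<beta> bp(1)])
  have \<psi>: "\<psi> \<in> ring_hom ring_of_type_algebra B"
    unfolding \<psi>_def by (rule poly_eval_hom[OF Bc \<psi>1 bq(1)])
  have \<psi>_const: "\<psi> [:[:c:]:] = \<beta> c" for c
    unfolding \<psi>_def poly_eval_const[OF Bc \<psi>1 bq(1)] unfolding \<psi>1_def by (rule poly_eval_const[OF Bc \<beta> bp(1)])
  have \<psi>_p: "\<psi> poly_p = bp"
    unfolding \<psi>_def poly_p_def poly_eval_const[OF Bc \<psi>1 bq(1)]
    unfolding \<psi>1_def by (rule poly_eval_X[OF Bc \<beta> bp(1)])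
  have \<psi>_q: "\<psi> poly_q = bq"
    unfolding \<psi>_def poly_q_def by (rule poly_eval_X[OF Bc \<psi>1 bq(1)])
  have coset_hom: "(+>\<^bsub>B\<^esub>) I \<in> ring_hom B (B Quot I)" by (rule I.rcos_ring_hom)
  have f\<psi>: "f (hopf_frac x) = I +>\<^bsub>B\<^esub> \<psi> x" for x
  proof -
    have "(\<lambda>x. f (hopf_frac x)) \<in> ring_hom ring_of_type_algebra (B Quot I)"
      using ring_hom_trans[OF hopf_frac_hom f] by (simp add: comp_def)
    moreover have "(\<lambda>x. I +>\<^bsub>B\<^esub> \<psi> x) \<in> ring_hom ring_of_type_algebra (B Quot I)"
      using ring_hom_trans[OF \<psi> coset_hom] by (simp add: comp_def)
    ultimately show ?thesis
      by (rule poly_pq_hom_eq) (simp_all add: f\<beta> \<psi>_const \<psi>_p \<psi>_q bp bq)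
  qed
  have \<psi>_closed: "\<psi> x \<in> carrier B" for x using ring_hom_closed[OF \<psi>] by simp
  let ?t = "1 + poly_p * poly_q"
  have t: "?t \<in> hopf_denominators" using hopf_denominators_power[of 1] by simp
  have v: "fraction hopf_denominators 1 ?t \<in> carrier hopf_localization"
    using hopf.fraction_carrier[OF t] by (simp add: hopf_localization_def)
  obtain b where b: "b \<in> carrier B" "f (fraction hopf_denominators 1 ?t) = I +>\<^bsub>B\<^esub> b"
    using lift[OF v] by blast
  have "hopf_frac ?t \<otimes>\<^bsub>hopf_localization\<^esub> fraction hopf_denominators 1 ?t = \<one>\<^bsub>hopf_localization\<^esub>"
    using hopf.fraction_denominator[OF t, of 1] L.m_comm[OF frac v]
    by (simp add: hopf_frac_def hopf_localization_def hopf.one_localization)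
  then have "(I +>\<^bsub>B\<^esub> \<psi> ?t) \<otimes>\<^bsub>B Quot I\<^esub> (I +>\<^bsub>B\<^esub> b) = I +>\<^bsub>B\<^esub> \<one>\<^bsub>B\<^esub>"
    using ring_hom_mult[OF f frac v] ring_hom_one[OF f] ring_hom_one[OF coset_hom] b f\<psi> by metis
  then have "I +>\<^bsub>B\<^esub> (\<psi> ?t \<otimes>\<^bsub>B\<^esub> b) = I +>\<^bsub>B\<^esub> \<one>\<^bsub>B\<^esub>"
    using ring_hom_mult[OF coset_hom \<psi>_closed b(1)] by simp
  then have unit: "\<psi> ?t \<in> Units B"
    using unit_lift_square_zero[OF Bc I _ \<psi>_closed b(1)] sq by blast
  have "\<psi> (?t ^ n) \<in> Units B" for n
  proof (induction n)
    case 0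
    then show ?case using ring_hom_one[OF \<psi>] by simp
  next
    case (Suc n)
    then show ?case using ring_hom_mult[OF \<psi>, of ?t "?t ^ n"] unit by simp
  qed
  then have units: "\<psi> s \<in> Units B" if "s \<in> hopf_denominators" for s
    using that unfolding hopf_denominators_def by auto
  let ?g = "hopf.localization_lift \<psi> B"
  have g: "?g \<in> ring_hom hopf_localization B"
    unfolding hopf_localization_def by (rule hopf.localization_lift_hom[OF Bc \<psi> units])
  have g_frac: "?g (hopf_frac x) = \<psi> x" for x
    unfolding hopf_frac_def by (rule hopf.localization_lift_canonical[OF Bc \<psi> units])
  have "I +>\<^bsub>B\<^esub> ?g x = f x" if "x \<in> carrier hopf_localization" for x
  proof (rule hopf.localization_hom_eq[where B = "B Quot I"])
    show "(\<lambda>x. I +>\<^bsub>B\<^esub> ?g x) \<in> ring_hom (localization hopf_denominators) (B Quot I)"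
      using ring_hom_trans[OF g coset_hom] by (simp add: comp_def hopf_localization_def)
    show "f \<in> ring_hom (localization hopf_denominators) (B Quot I)"
      using f by (simp add: hopf_localization_def)
    show "x \<in> carrier (localization hopf_denominators)"
      using that by (simp add: hopf_localization_def)
    fix a
    show "I +>\<^bsub>B\<^esub> ?g (fraction hopf_denominators a 1) = f (fraction hopf_denominators a 1)"
      using f\<psi>[of a] g_frac[of a] by (simp add: hopf_frac_def)
  qed (rule I.quotient_is_ring)
  then have "(\<forall>c. ?g (hopf_frac [:[:c:]:]) = \<beta> c) \<and>
      (\<forall>x\<in>carrier hopf_localization. I +>\<^bsub>B\<^esub> ?g x = f x)"
    by (simp add: g_frac \<psi>_const)
  then show "\<exists>g\<in>ring_hom hopf_localization B. (\<forall>c. g (hopf_frac [:[:c:]:]) = \<beta> c) \<and>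
      (\<forall>x\<in>carrier hopf_localization. I +>\<^bsub>B\<^esub> g x = f x)"
    using g by (rule bexI)
qed

lemma smooth_affine_hopf_localization:
  "smooth_affine_algebra TYPE('b) hopf_localization (\<lambda>c. hopf_frac [:[:c:]:])"
  by (simp add: smooth_affine_algebra_def affine_algebra_hopf_localization
      formally_smooth_hopf_localization)

section \<open>The homology is the localization\<close>

lemma hopf_ev_degree_nonzero:
  assumes "x \<in> hopf_degree_part n" "n \<noteq> 0"
  shows "hopf_ev x = 0"
proof -
  \<comment> \<open>A word of nonzero degree contains a letter \<open>a1\<close> or \<open>a2\<close>.\<close>
  have "word_ev w = 0" if "word_degree w \<noteq> 0" for w
    using that
  proof (induction w)
    case (Gen m g w)
    then show ?case by (cases g) simp_all
  qed simp
  then show ?thesis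
    using assms unfolding hopf_ev_def word_lin_def hopf_degree_part_def
    by (intro sum.neutral) auto
qed

lemma hopf_ev_surj:
  assumes "r \<in> loc_fractions"
  obtains x where "x \<in> hopf_degree_part 0" "hopf_ev x = r"
proof -
  have poly: "\<exists>x\<in>hopf_degree_part 0. hopf_ev x = to_fract f" for f
  proof (induction f rule: poly_pq_induct)
    case (const c)
    show ?case using degree_part_scalar hopf_ev_hopf_scalar by blast
  next
    case (add f g)
    then obtain x y where "x \<in> hopf_degree_part 0" "y \<in> hopf_degree_part 0"
      "hopf_ev x = to_fract f" "hopf_ev y = to_fract g" by blast
    then show ?case by (intro bexI[of _ "x + y"]) (simp_all add: hopf_ev_add degree_part_add)
  next
    case (p f)
    then obtain x where x: "x \<in> hopf_degree_part 0" "hopf_ev x = to_fract f" by blast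
    show ?case
      using degree_part_mult[OF degree_part_gen[of P] x(1)] x(2)
      by (intro bexI[of _ "hopf_p * x"]) (simp_all add: hopf_ev_mult hopf_ev_gen)
  next
    case (q f)
    then obtain x where x: "x \<in> hopf_degree_part 0" "hopf_ev x = to_fract f" by blast
    show ?case
      using degree_part_mult[OF degree_part_gen[of Q] x(1)] x(2)
      by (intro bexI[of _ "hopf_q * x"]) (simp_all add: hopf_ev_mult hopf_ev_gen)
  qed
  obtain f n where r: "r = to_fract f / frac_t ^ n" using assms by (rule loc_fractions_cases)
  obtain x where x: "x \<in> hopf_degree_part 0" "hopf_ev x = to_fract f" using poly by blast
  have "hopf_ev (x * hopf_t (- int n)) = r"
    unfolding r hopf_ev_mult hopf_ev_t x(2)
    by (simp only: power_int_minus power_int_of_nat divide_inverse)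
  moreover have "x * hopf_t (- int n) \<in> hopf_degree_part 0"
    using degree_part_mult[OF x(1) degree_part_t] by simp
  ultimately show thesis by (rule that[rotated])
qed

lemma degree_zero_cycle:
  assumes "x \<in> hopf_degree_part 0"
  shows "explicit_d x = 0"
proof -
  have "word_d w = 0" if "word_degree w = 0" for w
    using that
  proof (induction w)
    case (Gen m g w)
    then show ?case by (cases g) simp_all
  qed simp
  then show ?thesis
    using assms unfolding explicit_d_def hopf_degree_part_def by (intro sum.neutral) auto
qed

lemma hopf_cycles_eq: "hopf_cycles = {x. explicit_d x = 0}"
  by (simp add: hopf_cycles_def hopf_d_eq_explicit_d)

text \<open>
  The only place where the contraction is used: on a cycle \<open>x\<close> with \<open>ev(x) = 0\<close> it reads \<open>x = d(h(x))\<close>.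
\<close>

lemma hopf_boundaries_eq: "hopf_boundaries = {x \<in> hopf_cycles. hopf_ev x = 0}"
proof (rule Set.set_eqI)
  fix x
  have "x \<in> hopf_boundaries" if "explicit_d x = 0" "hopf_ev x = 0"
  proof -
    have "loc_section 0 = 0"
      using contraction[of 0] by (simp add: homotopy_0 explicit_d_0 hopf_ev_0)
    then have "x = explicit_d (homotopy x)"
      using contraction[of x] that by (simp add: homotopy_0)
    then show ?thesis unfolding hopf_boundaries_def hopf_d_eq_explicit_d by blast
  qed
  moreover have "hopf_ev x = 0 \<and> explicit_d x = 0" if "x \<in> hopf_boundaries"
    using that hopf_ev_explicit_d hopf_d_square
    unfolding hopf_boundaries_def hopf_d_eq_explicit_d by auto
  ultimately show "x \<in> hopf_boundaries \<longleftrightarrow> x \<in> {x \<in> hopf_cycles. hopf_ev x = 0}"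
    unfolding hopf_cycles_eq by blast
qed

lemma ring_hopf_cycle_ring: "ring hopf_cycle_ring"
  unfolding hopf_cycle_ring_def hopf_cycles_eq
proof (rule ringI)
  show "abelian_group (ring_of_type_algebra\<lparr>carrier := {x. explicit_d x = 0}\<rparr>)"
  proof (rule abelian_groupI)
    fix x assume "x \<in> carrier (ring_of_type_algebra\<lparr>carrier := {x. explicit_d x = 0}\<rparr>)"
    then show "\<exists>y\<in>carrier (ring_of_type_algebra\<lparr>carrier := {x. explicit_d x = 0}\<rparr>).
        y \<oplus>\<^bsub>ring_of_type_algebra\<lparr>carrier := {x. explicit_d x = 0}\<rparr>\<^esub> x
        = \<zero>\<^bsub>ring_of_type_algebra\<lparr>carrier := {x. explicit_d x = 0}\<rparr>\<^esub>"
      by (intro bexI[of _ "- x"]) (simp_all add: explicit_d_uminus)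
  qed (simp_all add: explicit_d_add explicit_d_0 add_ac)
  show "monoid (ring_of_type_algebra\<lparr>carrier := {x. explicit_d x = 0}\<rparr>)"
    by (rule monoidI) (simp_all add: explicit_d_mult_cycle explicit_d_1 mult.assoc)
qed (simp_all add: distrib_left distrib_right)

definition loc_ring :: "complex poly poly fract ring" where
  "loc_ring = ring_of_type_algebra\<lparr>carrier := loc_fractions\<rparr>"

lemma loc_fractions_uminus: "r \<in> loc_fractions \<Longrightarrow> - r \<in> loc_fractions"
  using loc_fractions_mult[OF loc_fractions_to_fract[of "- 1"], of r] by simp

lemma cring_loc_ring: "cring loc_ring"
  unfolding loc_ring_def
proof (rule cringI)
  show "abelian_group (ring_of_type_algebra\<lparr>carrier := loc_fractions\<rparr>)"
  proof (rule abelian_groupI)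
    fix x assume "x \<in> carrier (ring_of_type_algebra\<lparr>carrier := loc_fractions\<rparr>)"
    then show "\<exists>y\<in>carrier (ring_of_type_algebra\<lparr>carrier := loc_fractions\<rparr>).
        y \<oplus>\<^bsub>ring_of_type_algebra\<lparr>carrier := loc_fractions\<rparr>\<^esub> x
        = \<zero>\<^bsub>ring_of_type_algebra\<lparr>carrier := loc_fractions\<rparr>\<^esub>"
      by (intro bexI[of _ "- x"]) (simp_all add: loc_fractions_uminus)
  qed (simp_all add: loc_fractions_closed add_ac)
  show "comm_monoid (ring_of_type_algebra\<lparr>carrier := loc_fractions\<rparr>)"
    by (rule comm_monoidI) (simp_all add: loc_fractions_closed mult_ac)
qed (simp_all add: distrib_right)

lemma homology_iso:
  defines "\<Phi> \<equiv> (\<lambda>Z. the_elem (hopf_ev ` Z))"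
  shows "\<Phi> \<in> ring_iso hopf_homology loc_ring"
    and "x \<in> hopf_cycles \<Longrightarrow> \<Phi> (homology_class x) = hopf_ev x"
proof -
  interpret C: ring hopf_cycle_ring by (rule ring_hopf_cycle_ring)
  interpret K: cring loc_ring by (rule cring_loc_ring)
  interpret ring_hom_ring hopf_cycle_ring loc_ring hopf_ev
  proof (rule ring_hom_ringI2)
    show "hopf_ev \<in> ring_hom hopf_cycle_ring loc_ring"
      by (rule ring_hom_memI)
        (simp_all add: hopf_cycle_ring_def loc_ring_def hopf_ev_in_loc_fractions hopf_ev_add
          hopf_ev_mult hopf_ev_1)
  qed (rule C.ring_axioms, rule K.ring_axioms)
  have ker: "a_kernel hopf_cycle_ring loc_ring hopf_ev = hopf_boundaries"
    unfolding a_kernel_def' hopf_boundaries_eq by (simp add: hopf_cycle_ring_def loc_ring_def)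
  have "hopf_ev ` carrier hopf_cycle_ring = carrier loc_ring"
  proof
    show "hopf_ev ` carrier hopf_cycle_ring \<subseteq> carrier loc_ring"
      by (auto simp: loc_ring_def hopf_ev_in_loc_fractions)
    show "carrier loc_ring \<subseteq> hopf_ev ` carrier hopf_cycle_ring"
    proof
      fix r assume "r \<in> carrier loc_ring"
      then obtain x where "x \<in> hopf_degree_part 0" "hopf_ev x = r"
        using hopf_ev_surj[of r] by (auto simp: loc_ring_def)
      then show "r \<in> hopf_ev ` carrier hopf_cycle_ring"
        using degree_zero_cycle by (auto simp: hopf_cycle_ring_def hopf_cycles_eq)
    qed
  qed
  from FactRing_iso_set[OF this]
  show "\<Phi> \<in> ring_iso hopf_homology loc_ring"
    unfolding ker hopf_homology_def \<Phi>_def .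
  show "\<Phi> (homology_class x) = hopf_ev x" if "x \<in> hopf_cycles"
    unfolding \<Phi>_def homology_class_def ker[symmetric]
    by (rule the_elem_simp) (simp add: hopf_cycle_ring_def that)
qed

text \<open>
  The abstract localization, made of equivalence classes of pairs, is identified with its copy in the
  field of fractions.
\<close>

lemma localization_iso:
  obtains \<kappa> where "\<kappa> \<in> ring_iso hopf_localization loc_ring" "\<And>f. \<kappa> (hopf_frac f) = to_fract f"
proof -
  interpret K: cring loc_ring by (rule cring_loc_ring)
  have hom: "to_fract \<in> ring_hom ring_of_type_algebra loc_ring"
    by (rule ring_hom_memI) (simp_all add: loc_ring_def loc_fractions_to_fract)
  have unit: "to_fract s \<in> Units loc_ring" if s: "s \<in> hopf_denominators" for s
  proof -
    obtain n where n: "s = (1 + poly_p * poly_q) ^ n" using s unfolding hopf_denominators_def by blast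
    have "frac_t powi (- int n) * to_fract s = 1" "to_fract s * frac_t powi (- int n) = 1"
      unfolding n to_fract_power using frac_t_nonzero
      by (simp_all only: power_int_minus power_int_of_nat left_inverse right_inverse power_not_zero
          not_False_eq_True)
    then show ?thesis
      unfolding Units_def using loc_fractions_t loc_fractions_to_fract
      by (auto simp: loc_ring_def)
  qed
  define \<kappa> where "\<kappa> = hopf.localization_lift to_fract loc_ring"
  have \<kappa>: "\<kappa> \<in> ring_hom hopf_localization loc_ring"
    unfolding \<kappa>_def hopf_localization_def by (rule hopf.localization_lift_hom[OF cring_loc_ring hom unit])
  have frac: "\<kappa> (hopf_frac f) = to_fract f" for f
    unfolding \<kappa>_def hopf_frac_def by (rule hopf.localization_lift_canonical[OF cring_loc_ring hom unit])
  have fraction_val: "\<kappa> (fraction hopf_denominators a s) = to_fract a / to_fract s" "to_fract s \<noteq> 0"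
    if s: "s \<in> hopf_denominators" for a s
  proof -
    obtain n where n: "s = (1 + poly_p * poly_q) ^ n" using s unfolding hopf_denominators_def by blast
    show nz: "to_fract s \<noteq> 0" unfolding n using one_plus_pq_nonzero by simp
    have "\<kappa> (fraction hopf_denominators a s) \<otimes>\<^bsub>loc_ring\<^esub> to_fract s = to_fract a"
      unfolding \<kappa>_def
      by (subst hopf.localization_lift_fraction[OF cring_loc_ring hom _ s], erule unit)
        (rule hopf.localization_lift_cancel[OF cring_loc_ring hom _ s], erule unit)
    then have "\<kappa> (fraction hopf_denominators a s) * to_fract s = to_fract a"
      by (simp add: loc_ring_def)
    with nz show "\<kappa> (fraction hopf_denominators a s) = to_fract a / to_fract s"
      by (simp add: eq_divide_eq)
  qed
  have "inj_on \<kappa> (carrier hopf_localization)"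
  proof (rule inj_onI)
    fix x y assume x: "x \<in> carrier hopf_localization" and y: "y \<in> carrier hopf_localization"
      and eq: "\<kappa> x = \<kappa> y"
    obtain a s where a: "s \<in> hopf_denominators" "x = fraction hopf_denominators a s"
      using x unfolding hopf_localization_def by (rule hopf.localization_cases)
    obtain b t where b: "t \<in> hopf_denominators" "y = fraction hopf_denominators b t"
      using y unfolding hopf_localization_def by (rule hopf.localization_cases)
    have "to_fract (a * t) = to_fract (b * s)"
      using eq fraction_val[OF a(1)] fraction_val[OF b(1)] unfolding a b by (simp add: frac_eq_eq)
    then show "x = y" unfolding a b by (intro hopf.fraction_eqI a b) (simp only: to_fract_eq_iff)
  qed
  moreover have "\<kappa> ` carrier hopf_localization = carrier loc_ring"
  proof
    show "\<kappa> ` carrier hopf_localization \<subseteq> carrier loc_ring" using ring_hom_closed[OF \<kappa>] by blast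
    show "carrier loc_ring \<subseteq> \<kappa> ` carrier hopf_localization"
    proof
      fix r assume "r \<in> carrier loc_ring"
      then obtain f n where "r = to_fract f / frac_t ^ n"
        by (auto simp: loc_ring_def elim: loc_fractions_cases)
      then have "r = \<kappa> (fraction hopf_denominators f ((1 + poly_p * poly_q) ^ n))"
        by (simp only: fraction_val[OF hopf_denominators_power] to_fract_power)
      then show "r \<in> \<kappa> ` carrier hopf_localization"
        using hopf.fraction_carrier[OF hopf_denominators_power] unfolding hopf_localization_def by blast
    qed
  qed
  ultimately have "\<kappa> \<in> ring_iso hopf_localization loc_ring"
    using \<kappa> by (simp add: ring_iso_def bij_betw_def)
  then show thesis using frac by (rule that)
qed

theorem theorem3p13:
  shows "(\<exists>\<phi> \<in> ring_iso hopf_homology hopf_localization.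
            (\<forall>c. \<phi> (homology_class (hopf_scalar c)) = hopf_frac [:[:c:]:]) \<and>
            \<phi> (homology_class (hopf_gen P)) = hopf_frac poly_p \<and>
            \<phi> (homology_class (hopf_gen Q)) = hopf_frac poly_q \<and>
            (\<forall>n. \<phi> ` homology_degree_part n =
                   (if n = 0 then carrier hopf_localization else {\<zero>\<^bsub>hopf_localization\<^esub>})))
         \<and> smooth_affine_algebra TYPE('b) hopf_localization (\<lambda>c. hopf_frac [:[:c:]:])"
proof (rule conjI)
  interpret L: cring hopf_localization by (rule cring_hopf_localization)
  define \<Phi> where "\<Phi> = (\<lambda>Z. the_elem (hopf_ev ` Z))"
  obtain \<kappa> where \<kappa>: "\<kappa> \<in> ring_iso hopf_localization loc_ring"
    and \<kappa>_frac: "\<And>f. \<kappa> (hopf_frac f) = to_fract f" by (rule localization_iso) blast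
  let ?\<theta> = "inv_into (carrier hopf_localization) \<kappa>"
  have inj: "inj_on \<kappa> (carrier hopf_localization)"
    and image: "\<kappa> ` carrier hopf_localization = carrier loc_ring"
    using \<kappa> unfolding ring_iso_def bij_betw_def by auto
  have frac: "hopf_frac f \<in> carrier hopf_localization" for f
    using ring_hom_closed[OF hopf_frac_hom] by simp
  have \<theta>_frac: "?\<theta> (to_fract f) = hopf_frac f" for f
    using inv_into_f_f[OF inj frac, of f] by (simp add: \<kappa>_frac)
  have on_class: "(?\<theta> \<circ> \<Phi>) (homology_class x) = ?\<theta> (hopf_ev x)" if "x \<in> hopf_cycles" for x
    using homology_iso(2)[OF that] by (simp add: \<Phi>_def)
  have cycle: "x \<in> hopf_cycles" if "x \<in> hopf_degree_part 0" for x
    using degree_zero_cycle[OF that] by (simp add: hopf_cycles_eq)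
  have "(?\<theta> \<circ> \<Phi>) \<in> ring_iso hopf_homology hopf_localization"
    using homology_iso(1) ring_iso_set_sym[OF L.ring_axioms \<kappa>] unfolding \<Phi>_def by (rule ring_iso_set_trans)
  moreover have "(?\<theta> \<circ> \<Phi>) (homology_class (hopf_scalar c)) = hopf_frac [:[:c:]:]" for c
    using on_class[OF cycle[OF degree_part_scalar]] by (simp only: hopf_ev_hopf_scalar \<theta>_frac)
  moreover have "(?\<theta> \<circ> \<Phi>) (homology_class (hopf_gen P)) = hopf_frac poly_p"
    using on_class[OF cycle, of hopf_p] degree_part_gen[of P]
    by (simp only: hopf_ev_gen gen_ev.simps \<theta>_frac gen_degree.simps of_nat_0)
  moreover have "(?\<theta> \<circ> \<Phi>) (homology_class (hopf_gen Q)) = hopf_frac poly_q"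
    using on_class[OF cycle, of hopf_q] degree_part_gen[of Q]
    by (simp only: hopf_ev_gen gen_ev.simps \<theta>_frac gen_degree.simps of_nat_0)
  moreover have "(?\<theta> \<circ> \<Phi>) ` homology_degree_part n
      = (if n = 0 then carrier hopf_localization else {\<zero>\<^bsub>hopf_localization\<^esub>})" for n
  proof -
    have "(?\<theta> \<circ> \<Phi>) ` homology_degree_part n = ?\<theta> ` hopf_ev ` (hopf_cycles \<inter> hopf_degree_part n)"
      unfolding homology_degree_part_def image_image using on_class by (intro image_cong) simp_all
    also have "hopf_ev ` (hopf_cycles \<inter> hopf_degree_part n) = (if n = 0 then loc_fractions else {0})"
    proof (cases "n = 0")
      case True
      have "loc_fractions \<subseteq> hopf_ev ` (hopf_cycles \<inter> hopf_degree_part 0)"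
        using cycle by (blast elim: hopf_ev_surj)
      with True show ?thesis using hopf_ev_in_loc_fractions by auto
    next
      case False
      have "0 \<in> hopf_cycles" by (simp add: hopf_cycles_eq explicit_d_0)
      then have "0 \<in> hopf_ev ` (hopf_cycles \<inter> hopf_degree_part n)"
        using degree_part_0 hopf_ev_0 by (metis IntI imageI)
      with False show ?thesis using hopf_ev_degree_nonzero by auto
    qed
    also have "?\<theta> ` \<dots> = (if n = 0 then carrier hopf_localization else {\<zero>\<^bsub>hopf_localization\<^esub>})"
    proof (cases "n = 0")
      case True
      have "?\<theta> ` \<kappa> ` carrier hopf_localization = carrier hopf_localization"
        using inj by (rule inv_into_image_cancel) simp
      with True show ?thesis by (simp add: image loc_ring_def)
    next
      case False
      have "?\<theta> 0 = \<zero>\<^bsub>hopf_localization\<^esub>"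
        using \<theta>_frac[of 0] by (simp add: hopf_frac_def hopf_localization_def hopf.zero_localization)
      with False show ?thesis by simp
    qed
    finally show ?thesis .
  qed
  ultimately show "\<exists>\<phi> \<in> ring_iso hopf_homology hopf_localization.
            (\<forall>c. \<phi> (homology_class (hopf_scalar c)) = hopf_frac [:[:c:]:]) \<and>
            \<phi> (homology_class (hopf_gen P)) = hopf_frac poly_p \<and>
            \<phi> (homology_class (hopf_gen Q)) = hopf_frac poly_q \<and>
            (\<forall>n. \<phi> ` homology_degree_part n =
                   (if n = 0 then carrier hopf_localization else {\<zero>\<^bsub>hopf_localization\<^esub>}))"
    by blast
qed (rule smooth_affine_hopf_localization)

end
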